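(* Let $n\ge1$, let $\alpha\in\{1,\ldots,2n+1\}\setminus\{2\}$ and let $\mu$ be an $\alpha$-uniform measure on $\mathbb{H}^n$. Then there are $b\in\mathbb{R}^{2n}$, $\mathcal{T}\in\mathbb{R}$ and a symmetric matrix $\mathcal{Q}\in\mathrm{Sym}(2n)$ with $\mathrm{Tr}(\mathcal{Q})\neq0$ such that $$\mathrm{supp}(\mu)\subseteq\mathbb{K}(b,\mathcal{Q},\mathcal{T}):=\{(x,t)\in\mathbb{R}^{2n}\times\mathbb{R}:\langle b,x\rangle+\langle x,\mathcal{Q}x\rangle+\mathcal{T}t=0\}.$$
   Context: The Heisenberg group $\mathbb{H}^n$ is $\mathbb{R}^{2n}\times\mathbb{R}$, with points $x=(x_H,x_T)$ and product $x*y=(x_H+y_H,\,x_T+y_T+2\langle x_H,Jy_H\rangle)$, where $J=\begin{pmatrix}0&\mathrm{id}_n\\-\mathrm{id}_n&0\end{pmatrix}$. The Koranyi norm is $\|x\|=(|x_H|^4+|x_T|^2)^{1/4}$, the Koranyi distance is $d(x,y)=\|x^{-1}*y\|$, and $B_r(x)=\{z: d(z,x)\le r\}$. A Radon measure $\mu$ on $\mathbb{H}^n$ is $\alpha$-uniform if $0\in\mathrm{supp}(\mu)$ and $\mu(B_r(x))=r^\alpha$ for every $r>0$ and every $x\in\mathrm{supp}(\mu)$. $\mathrm{Sym}(2n)$ is the set of real symmetric $2n\times2n$ matrices. *)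

theory Defs
  imports "HOL-Analysis.Analysis"
begin

text \<open>
  A vector of \<open>\<real>\<^sup>2\<^sup>n\<close> is indexed by \<open>'n + 'n\<close> with \<open>n = CARD('n)\<close>: \<open>Inl\<close> gives the first \<open>n\<close>
  coordinates and \<open>Inr\<close> the last \<open>n\<close>. The topology (hence the Borel sets) on \<open>'n heis\<close> is the
  Euclidean one, which is also the topology induced by the Koranyi distance.
\<close>

type_synonym 'n heis = "(real ^ ('n + 'n)) \<times> real"

definition heis_J :: "real ^ ('n::finite + 'n) ^ ('n + 'n)" where
  "heis_J = (\<chi> i j. case (i, j) of
      (Inl k, Inr l) \<Rightarrow> if k = l then 1 else 0
    | (Inr k, Inl l) \<Rightarrow> if k = l then - 1 else 0
    | _ \<Rightarrow> 0)"

definition heis_mult :: "'n::finite heis \<Rightarrow> 'n heis \<Rightarrow> 'n heis" where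
  "heis_mult x y = (fst x + fst y, snd x + snd y + 2 * (fst x \<bullet> (heis_J *v fst y)))"

definition heis_inv :: "'n::finite heis \<Rightarrow> 'n heis" where
  "heis_inv x = (- fst x, - snd x)"

definition koranyi_norm :: "'n::finite heis \<Rightarrow> real" where
  "koranyi_norm x = root 4 (norm (fst x) ^ 4 + \<bar>snd x\<bar> ^ 2)"

definition koranyi_dist :: "'n::finite heis \<Rightarrow> 'n heis \<Rightarrow> real" where
  "koranyi_dist x y = koranyi_norm (heis_mult (heis_inv x) y)"

definition koranyi_cball :: "'n::finite heis \<Rightarrow> real \<Rightarrow> 'n heis set" where
  "koranyi_cball x r = {z. koranyi_dist z x \<le> r}"

definition radon_measure :: "'a::topological_space measure \<Rightarrow> bool" where
  "radon_measure M \<longleftrightarrow>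
     sets M = sets borel \<and>
     (\<forall>K. compact K \<longrightarrow> emeasure M K < \<infinity>) \<and>
     (\<forall>A\<in>sets borel. emeasure M A = (INF U\<in>{U. open U \<and> A \<subseteq> U}. emeasure M U)) \<and>
     (\<forall>U. open U \<longrightarrow> emeasure M U = (SUP K\<in>{K. compact K \<and> K \<subseteq> U}. emeasure M K))"

definition msupp :: "'a::topological_space measure \<Rightarrow> 'a set" where
  "msupp M = {x. \<forall>U. open U \<and> x \<in> U \<longrightarrow> emeasure M U > 0}"

definition heis_uniform :: "real \<Rightarrow> 'n::finite heis measure \<Rightarrow> bool" where
  "heis_uniform \<alpha> \<mu> \<longleftrightarrow>
     radon_measure \<mu> \<and> 0 \<in> msupp \<mu> \<and>
     (\<forall>x\<in>msupp \<mu>. \<forall>r>0. emeasure \<mu> (koranyi_cball x r) = ennreal (r powr \<alpha>))"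

definition heis_quadric ::
  "real ^ ('n::finite + 'n) \<Rightarrow> real ^ ('n + 'n) ^ ('n + 'n) \<Rightarrow> real \<Rightarrow> 'n heis set" where
  "heis_quadric b Q T = {(x, t). b \<bullet> x + x \<bullet> (Q *v x) + T * t = 0}"

lemma inner_heis_J:
  fixes x y :: "real ^ ('n::finite + 'n)"
  shows "x \<bullet> (heis_J *v y) = (\<Sum>k\<in>UNIV. x $ Inl k * y $ Inr k - x $ Inr k * y $ Inl k)"
proof -
  have sum_plus: "(\<Sum>i\<in>UNIV. f i) = (\<Sum>k\<in>UNIV. f (Inl k)) + (\<Sum>k\<in>UNIV. f (Inr k))"
    for f :: "'n + 'n \<Rightarrow> real"
    by (simp add: UNIV_Plus_UNIV[symmetric] sum.Plus del: UNIV_Plus_UNIV)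
  show ?thesis
    by (simp add: inner_vec_def matrix_vector_mult_def heis_J_def sum_plus if_distrib
        if_distribR sum.delta sum_subtractf sum_negf cong: if_cong)
qed

lemma heis_mult_assoc: "heis_mult (heis_mult x y) z = heis_mult x (heis_mult y z)"
  by (simp add: heis_mult_def matrix_vector_right_distrib inner_add_left inner_add_right
      algebra_simps)

lemma heis_mult_zero: "heis_mult 0 x = x" "heis_mult x 0 = x"
  by (simp_all add: heis_mult_def)

lemma heis_mult_inv: "heis_mult (heis_inv x) x = 0" "heis_mult x (heis_inv x) = 0"
  by (simp_all add: heis_mult_def heis_inv_def inner_heis_J mult.commute prod_eq_iff)

end

theory Submission
  imports Defs
begin

text \<open>
  Write \<open>q(z)\<close> for the fourth power of the Koranyi norm. Since all balls of radius \<open>r\<close> centred on the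
  support have the same mass, \<open>\<integral> exp (- s d(u,z)\<^sup>4) d\<mu>(z)\<close> is the same for every \<open>u\<close> in the support
  (\<open>gauss_independent_of_center\<close>), in particular it equals the value at \<open>u = 0\<close>. Put \<open>s = l\<^sup>4\<close>, expand
  \<open>q(z) - d(u,z)\<^sup>4\<close> in powers of \<open>u\<close> and let \<open>l\<close> tend to \<open>0\<close>. In the dilated variable, the terms of
  degree at most two in \<open>u\<close> (where the vertical coordinate of \<open>u\<close> has degree two) form a quadric
  \<open>\<langle>b\<^sub>l,u\<rangle> + \<langle>u,Q\<^sub>l u\<rangle> + T\<^sub>l u\<^sub>T\<close>, which is therefore \<open>O(l)\<close> at each fixed \<open>u\<close> in the support
  (\<open>moment_expansion\<close>).

  It remains to produce from these approximate equations an exact one whose matrix has nonzero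
  trace. Finite-dimensional duality does this in place of a compactness argument
  (\<open>quadric_of_not_in_span\<close>): if every quadric that vanishes on the support had trace zero, then the
  trace would be a linear combination of finitely many evaluations at points of the support, and
  consequently the trace of \<open>Q\<^sub>l\<close> would tend to \<open>0\<close> (\<open>trace_tendsto_0\<close>).

  This is contradictory. With \<open>G(l) = l\<^sup>\<alpha> \<integral> \<bar>\<zeta>\<^sub>H\<bar>\<^sup>2 exp (- q(\<zeta>)) d\<mu>\<close>, where \<open>\<zeta>\<close> is the dilate of \<open>z\<close> by \<open>l\<close>,
  the trace of \<open>Q\<^sub>l\<close> equals \<open>- 2 l (l\<^sup>c G)' / l\<^sup>c\<close> with \<open>c = 2n + 2 - \<alpha>\<close>. Because \<open>c\<close> is positive and \<open>G\<close>
  is bounded, trace tending to \<open>0\<close> forces \<open>G\<close> to tend to \<open>0\<close> (\<open>gauss_width_small\<close>, in a discrete form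
  that avoids differentiating integrals). Then at some scale the support lies in an arbitrarily
  thin tube about the vertical axis, on which the Koranyi distance is nearly \<open>sqrt \<bar>t - t'\<bar>\<close>
  (\<open>axis_like_scale\<close>). So \<open>\<mu>\<close> looks like a measure on a line that gives mass \<open>\<rho> powr (\<alpha>/2)\<close> to each interval of
  half-length \<open>\<rho>\<close> centred on its support. For \<open>\<alpha> \<ge> 3\<close> a covering argument excludes this
  (\<open>axis_like_dim_less_3\<close>). For \<open>\<alpha> = 1\<close> the support can have no gap, because balls at the two ends
  of a gap would carry too much mass, and cannot fill an interval either, because too many disjoint
  balls would fit in (\<open>axis_like_dim_ne_1\<close>). The excluded dimension
  \<open>\<alpha> = 2\<close> is that of the vertical axis itself.
\<close>

section \<open>Koranyi geometry\<close>

text \<open>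
  Unlike the Koranyi norm and distance themselves, their fourth powers are polynomials in the
  coordinates, which makes an exact expansion possible.
\<close>

definition hnorm4 :: "'n::finite heis \<Rightarrow> real" where
  "hnorm4 z = norm (fst z) ^ 4 + (snd z)\<^sup>2"

definition hdist4 :: "'n::finite heis \<Rightarrow> 'n heis \<Rightarrow> real" where
  "hdist4 u z = norm (fst u - fst z) ^ 4 + (snd u - snd z + 2 * (fst u \<bullet> (heis_J *v fst z)))\<^sup>2"

definition dilate :: "real \<Rightarrow> 'n::finite heis \<Rightarrow> 'n heis" where
  "dilate l z = (l *\<^sub>R fst z, l\<^sup>2 * snd z)"

lemma sum_Plus_UNIV: "(\<Sum>i\<in>UNIV. f i) = (\<Sum>k\<in>UNIV. f (Inl k)) + (\<Sum>k\<in>UNIV. f (Inr k))"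
  for f :: "'n::finite + 'n \<Rightarrow> real"
  by (simp add: UNIV_Plus_UNIV[symmetric] sum.Plus del: UNIV_Plus_UNIV)

lemma heis_J_nth:
  fixes y :: "real ^ ('n::finite + 'n)"
  shows "(heis_J *v y) $ Inl k = y $ Inr k" and "(heis_J *v y) $ Inr k = - y $ Inl k"
  by (simp_all add: matrix_vector_mult_def heis_J_def sum_Plus_UNIV if_distribR sum.delta
      if_distrib[of "\<lambda>c. c * _"] sum_negf cong: if_cong)

lemma norm_heis_J: "norm (heis_J *v y) = norm (y :: real ^ ('n::finite + 'n))"
proof -
  have "(heis_J *v y) \<bullet> (heis_J *v y) = y \<bullet> y"
    by (simp add: inner_vec_def sum_Plus_UNIV heis_J_nth)
  then show ?thesis by (simp add: norm_eq_sqrt_inner)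
qed

lemma heis_J_skew: "y \<bullet> (heis_J *v x) = - (x \<bullet> (heis_J *v y))"
  for x y :: "real ^ ('n::finite + 'n)"
  by (simp add: inner_heis_J sum_negf[symmetric] mult.commute)

lemma heis_J_orthogonal: "x \<bullet> (heis_J *v x) = 0" for x :: "real ^ ('n::finite + 'n)"
  using heis_J_skew[of x x] by linarith

lemma heis_J_scaleR: "heis_J *v (c *\<^sub>R x) = c *\<^sub>R (heis_J *v (x :: real ^ ('n::finite + 'n)))"
  by (simp add: matrix_vector_mult_scaleR)

lemma abs_inner_heis_J: "\<bar>x \<bullet> (heis_J *v y)\<bar> \<le> norm x * norm (y :: real ^ ('n::finite + 'n))"
  using Cauchy_Schwarz_ineq2[of x "heis_J *v y"] by (simp add: norm_heis_J)

lemma hnorm4_nonneg [simp]: "0 \<le> hnorm4 z"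
  by (simp add: hnorm4_def)

lemma hdist4_nonneg [simp]: "0 \<le> hdist4 u z"
  by (simp add: hdist4_def)

lemma koranyi_dist_pow4: "koranyi_dist z u ^ 4 = hdist4 u z"
proof -
  have "koranyi_dist z u ^ 4 =
      norm (fst u - fst z) ^ 4 + (snd u - snd z - 2 * (fst z \<bullet> (heis_J *v fst u)))\<^sup>2"
    unfolding koranyi_dist_def koranyi_norm_def
    by (simp add: heis_mult_def heis_inv_def)
  then show ?thesis
    by (simp add: hdist4_def heis_J_skew[of "fst z" "fst u"])
qed

lemma koranyi_dist_nonneg [simp]: "0 \<le> koranyi_dist z u"
  by (simp add: koranyi_dist_def koranyi_norm_def)

lemma mem_koranyi_cball:
  assumes "0 \<le> r" shows "z \<in> koranyi_cball u r \<longleftrightarrow> hdist4 u z \<le> r ^ 4"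
  using assms power_mono_iff[of "koranyi_dist z u" r 4]
  by (simp add: koranyi_cball_def koranyi_dist_pow4[symmetric])

lemma hdist4_0: "hdist4 0 z = hnorm4 z"
  by (simp add: hdist4_def hnorm4_def)

lemma hnorm4_dilate: "hnorm4 (dilate l z) = l ^ 4 * hnorm4 z"
  by (simp add: hnorm4_def dilate_def power_mult_distrib distrib_left flip: power_mult)

lemma koranyi_norm_pow4: "koranyi_norm z ^ 4 = hnorm4 z"
  by (simp add: koranyi_norm_def hnorm4_def)

lemma koranyi_norm_nonneg [simp]: "0 \<le> koranyi_norm z"
  by (simp add: koranyi_norm_def)

lemma norm_fst_le: "norm (fst z) \<le> koranyi_norm z"
proof -
  have "norm (fst z) ^ 4 \<le> koranyi_norm z ^ 4"
    by (simp add: koranyi_norm_pow4 hnorm4_def)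
  then show ?thesis by (simp add: power_mono_iff)
qed

lemma abs_snd_le: "\<bar>snd z\<bar> \<le> (koranyi_norm z)\<^sup>2"
proof -
  have "(snd z)\<^sup>2 \<le> ((koranyi_norm z)\<^sup>2)\<^sup>2"
    by (simp add: koranyi_norm_pow4 hnorm4_def flip: power_mult)
  then have "\<bar>snd z\<bar> \<le> \<bar>(koranyi_norm z)\<^sup>2\<bar>" by (simp only: abs_le_square_iff)
  then show ?thesis by simp
qed

lemma dilate_dilate: "dilate a (dilate b z) = dilate (a * b) z"
  by (simp add: dilate_def power_mult_distrib)

lemma continuous_hdist4 [continuous_intros]: "continuous_on A (\<lambda>z. hdist4 u z)"
  unfolding hdist4_def
  by (intro continuous_intros linear_continuous_on_compose[OF _ matrix_vector_mul_linear])

lemma continuous_hnorm4 [continuous_intros]: "continuous_on A hnorm4"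
  using continuous_hdist4[of A 0] by (simp add: hdist4_0)

lemma continuous_dilate [continuous_intros]: "continuous_on A (dilate l)"
  unfolding dilate_def by (intro continuous_intros)

lemma continuous_heis_J [continuous_intros]:
  "continuous_on A f \<Longrightarrow> continuous_on A (\<lambda>z. (heis_J :: real ^ ('n::finite + 'n) ^ ('n + 'n)) *v f z)"
  by (rule continuous_on_compose2[OF matrix_vector_mult_linear_continuous_on[of UNIV]]) auto

text \<open>
  Used to read off coordinate bounds from a bound on \<open>hnorm4\<close> or \<open>hdist4\<close>, both of which have the form
  on the left.
\<close>

lemma quartic_sum_le:
  fixes x y :: real
  assumes "norm v ^ 4 + x\<^sup>2 \<le> y ^ 4"
  shows "0 \<le> y \<Longrightarrow> norm v \<le> y" and "\<bar>x\<bar> \<le> y\<^sup>2"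
proof -
  have "norm v ^ 4 \<le> y ^ 4" using assms zero_le_power2[of x] by linarith
  then show "0 \<le> y \<Longrightarrow> norm v \<le> y" by (simp add: power_mono_iff)
  have "0 \<le> norm v ^ 4" by simp
  moreover have "(y\<^sup>2)\<^sup>2 = y ^ 4" by (simp flip: power_mult)
  ultimately have "x\<^sup>2 \<le> (y\<^sup>2)\<^sup>2" using assms by linarith
  then have "\<bar>x\<bar> \<le> \<bar>y\<^sup>2\<bar>" by (simp only: abs_le_square_iff)
  then show "\<bar>x\<bar> \<le> y\<^sup>2" by simp
qed

text \<open>
  The skew form does not see the component of \<open>z\<close> along \<open>u\<close>, so its value at \<open>(u, z)\<close> is at most
  \<open>\<bar>u\<bar> \<bar>z - u\<bar>\<close>; this is what makes the vertical coordinate quadratically small. The factor \<open>2\<close> comes from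
  bounding the two coordinates separately.
\<close>

lemma hnorm4_quasi_triangle:
  assumes u: "hnorm4 u \<le> a ^ 4" and d: "hdist4 u z \<le> d ^ 4" and "0 \<le> a" "0 \<le> d"
  shows "norm (fst z) \<le> a + d" and "norm (fst u - fst z) \<le> d" and "hnorm4 z \<le> 2 * (a + d) ^ 4"
proof -
  note n1 = quartic_sum_le(1)[OF u[unfolded hnorm4_def] \<open>0 \<le> a\<close>]
  note n2 = quartic_sum_le(2)[OF u[unfolded hnorm4_def]]
  note n3 = quartic_sum_le(1)[OF d[unfolded hdist4_def] \<open>0 \<le> d\<close>]
  note n4 = quartic_sum_le(2)[OF d[unfolded hdist4_def]]
  show "norm (fst u - fst z) \<le> d" by (rule n3)
  show h1: "norm (fst z) \<le> a + d"
    using norm_triangle_sub[of "fst z" "fst u"] n1 n3 by (simp add: norm_minus_commute)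
  have "fst u \<bullet> (heis_J *v fst z) = - (fst u \<bullet> (heis_J *v (fst u - fst z)))"
    by (simp add: matrix_vector_mult_diff_distrib inner_diff_right heis_J_orthogonal)
  then have "\<bar>fst u \<bullet> (heis_J *v fst z)\<bar> \<le> norm (fst u) * norm (fst u - fst z)"
    using abs_inner_heis_J[of "fst u" "fst u - fst z"] by simp
  also have "\<dots> \<le> a * d" using n1 n3 assms by (intro mult_mono) auto
  finally have "\<bar>snd z\<bar> \<le> d\<^sup>2 + a\<^sup>2 + 2 * (a * d)" using n2 n4 by linarith
  then have h2: "\<bar>snd z\<bar> \<le> (a + d)\<^sup>2" by (simp add: power2_eq_square algebra_simps)
  have "norm (fst z) ^ 4 \<le> (a + d) ^ 4" using h1 by (intro power_mono) auto
  moreover have "(snd z)\<^sup>2 \<le> ((a + d)\<^sup>2)\<^sup>2" using power_mono[OF h2, of 2] by simp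
  ultimately show "hnorm4 z \<le> 2 * (a + d) ^ 4"
    by (simp add: hnorm4_def flip: power_mult)
qed

text \<open>
  In the tube of radius \<open>a\<close> about the vertical axis, the horizontal part contributes \<open>O(a\<^sup>4)\<close> to \<open>d\<^sup>4\<close> and
  the skew form shifts the difference of heights by \<open>O(a\<^sup>2)\<close>. Hence \<open>d\<^sup>2 = \<bar>t - t'\<bar> + O(a\<^sup>2)\<close>.
\<close>

lemma hdist4_near_axis:
  assumes x: "norm (fst p) \<le> a" and y: "norm (fst q) \<le> a"
  shows "hdist4 p q \<le> (\<bar>snd p - snd q\<bar> + 6 * a\<^sup>2)\<^sup>2"
    and "0 \<le> r \<Longrightarrow> hdist4 p q \<le> r ^ 4 \<Longrightarrow> \<bar>snd p - snd q\<bar> \<le> r\<^sup>2 + 6 * a\<^sup>2"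
proof -
  have a: "0 \<le> a" using x norm_ge_zero order_trans by blast
  define s where "s = fst p \<bullet> (heis_J *v fst q)"
  have "\<bar>s\<bar> \<le> norm (fst p) * norm (fst q)" unfolding s_def by (rule abs_inner_heis_J)
  also have "\<dots> \<le> a * a" using x y a by (intro mult_mono) auto
  finally have s: "\<bar>s\<bar> \<le> a\<^sup>2" by (simp add: power2_eq_square)
  have "norm (fst p - fst q) \<le> 2 * a" using norm_triangle_ineq4[of "fst p" "fst q"] x y by linarith
  then have "norm (fst p - fst q) ^ 4 \<le> (2 * a) ^ 4" by (intro power_mono) auto
  also have "\<dots> = (4 * a\<^sup>2)\<^sup>2" by (simp add: power_mult_distrib flip: power_mult)
  finally have n: "norm (fst p - fst q) ^ 4 \<le> (4 * a\<^sup>2)\<^sup>2" .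
  have "\<bar>snd p - snd q + 2 * s\<bar> \<le> \<bar>snd p - snd q\<bar> + 2 * a\<^sup>2" using s by linarith
  then have "(snd p - snd q + 2 * s)\<^sup>2 \<le> (\<bar>snd p - snd q\<bar> + 2 * a\<^sup>2)\<^sup>2"
    using power_mono[of "\<bar>snd p - snd q + 2 * s\<bar>" "\<bar>snd p - snd q\<bar> + 2 * a\<^sup>2" 2] by simp
  with n have "hdist4 p q \<le> (4 * a\<^sup>2)\<^sup>2 + (\<bar>snd p - snd q\<bar> + 2 * a\<^sup>2)\<^sup>2"
    by (simp add: hdist4_def s_def)
  also have "\<dots> \<le> (4 * a\<^sup>2 + (\<bar>snd p - snd q\<bar> + 2 * a\<^sup>2))\<^sup>2"
    using mult_nonneg_nonneg[of "4 * a\<^sup>2" "\<bar>snd p - snd q\<bar> + 2 * a\<^sup>2"] unfolding power2_sum by simp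
  finally show "hdist4 p q \<le> (\<bar>snd p - snd q\<bar> + 6 * a\<^sup>2)\<^sup>2" by (simp add: add_ac)
  assume r: "0 \<le> r" "hdist4 p q \<le> r ^ 4"
  have "\<bar>snd p - snd q + 2 * s\<bar> \<le> r\<^sup>2"
    using quartic_sum_le(2)[OF r(2)[unfolded hdist4_def]] by (simp add: s_def)
  moreover have "0 \<le> a\<^sup>2" by simp
  ultimately show "\<bar>snd p - snd q\<bar> \<le> r\<^sup>2 + 6 * a\<^sup>2" using s by linarith
qed

section \<open>Expansion of the fourth power of the distance\<close>

text \<open>
  The next three expressions are, up to a factor \<open>4\<close> in the first, the parts of \<open>hnorm4 z - hdist4 u z\<close>
  of degree one, two and three in \<open>u\<close>, when the vertical coordinate of \<open>u\<close> is given degree two. The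
  degree-one part is linear in the horizontal part of \<open>u\<close> and hence represented by a vector.
\<close>

definition lin_vec :: "'n::finite heis \<Rightarrow> real ^ ('n + 'n)" where
  "lin_vec z = (norm (fst z))\<^sup>2 *\<^sub>R fst z + snd z *\<^sub>R (heis_J *v fst z)"

definition quad_term :: "'n::finite heis \<Rightarrow> 'n heis \<Rightarrow> real" where
  "quad_term u z = - 4 * (fst u \<bullet> fst z)\<^sup>2 - 2 * (norm (fst z))\<^sup>2 * (norm (fst u))\<^sup>2
     - 4 * (fst u \<bullet> (heis_J *v fst z))\<^sup>2 + 2 * snd z * snd u"

definition cubic_term :: "'n::finite heis \<Rightarrow> 'n heis \<Rightarrow> real" where
  "cubic_term u z = 4 * (fst u \<bullet> fst z) * (norm (fst u))\<^sup>2 - 4 * snd u * (fst u \<bullet> (heis_J *v fst z))"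

lemma hdist4_expand:
  "hnorm4 z - hdist4 u z = 4 * (fst u \<bullet> lin_vec z) + quad_term u z + cubic_term u z - hnorm4 u"
proof -
  define a where "a = fst u \<bullet> fst z"
  define b where "b = fst u \<bullet> (heis_J *v fst z)"
  have n4: "norm x ^ 4 = ((norm x)\<^sup>2)\<^sup>2" for x :: "real ^ ('a::finite + 'a)"
    by (simp flip: power_mult)
  have "(norm (fst u - fst z))\<^sup>2 = (norm (fst u))\<^sup>2 + (norm (fst z))\<^sup>2 - 2 * a"
    by (simp add: a_def power2_norm_eq_inner inner_diff_left inner_diff_right inner_commute)
  moreover have "fst u \<bullet> lin_vec z = (norm (fst z))\<^sup>2 * a + snd z * b"
    by (simp add: a_def b_def lin_vec_def inner_add_right)
  ultimately show ?thesis
    unfolding hdist4_def hnorm4_def quad_term_def cubic_term_def n4 a_def[symmetric] b_def[symmetric]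
    by algebra
qed

lemma lin_vec_dilate: "lin_vec (dilate l z) = l ^ 3 *\<^sub>R lin_vec z"
  by (simp add: lin_vec_def dilate_def heis_J_scaleR power_mult_distrib scaleR_add_right
      power2_eq_square power3_eq_cube algebra_simps)

text \<open>
  The difference is homogeneous of degree four in \<open>(u, z)\<close> jointly. Hence, when \<open>z\<close> is replaced by its
  dilate and \<open>u\<close> is kept, the power of \<open>l\<close> in front of a term is its degree in \<open>u\<close>.
\<close>

lemma hdist4_expand_dilate:
  "l ^ 4 * (hnorm4 z - hdist4 u z) =
     l * (4 * (fst u \<bullet> lin_vec (dilate l z))) + l\<^sup>2 * quad_term u (dilate l z) + l ^ 3 * cubic_term u (dilate l z)
       - l ^ 4 * hnorm4 u"
proof -
  have "quad_term u (dilate l z) = l\<^sup>2 * quad_term u z"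
    by (simp add: quad_term_def dilate_def heis_J_scaleR power_mult_distrib algebra_simps)
  moreover have "cubic_term u (dilate l z) = l * cubic_term u z"
    by (simp add: cubic_term_def dilate_def heis_J_scaleR algebra_simps)
  ultimately show ?thesis
    unfolding hdist4_expand lin_vec_dilate
    by (simp add: algebra_simps power2_eq_square power3_eq_cube power4_eq_xxxx)
qed

text \<open>
  The two summands of \<open>lin_vec z\<close> are orthogonal and \<open>heis_J\<close> is an isometry.
\<close>

lemma norm_lin_vec_sq: "(norm (lin_vec z))\<^sup>2 = (norm (fst z))\<^sup>2 * hnorm4 z"
proof -
  define a where "a = fst z"
  have "lin_vec z \<bullet> lin_vec z = (norm a)\<^sup>2 * (norm a)\<^sup>2 * (a \<bullet> a)
      + snd z * snd z * ((heis_J *v a) \<bullet> (heis_J *v a))"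
    by (simp add: lin_vec_def a_def inner_add_left inner_add_right heis_J_orthogonal
        inner_commute[of "heis_J *v fst z" "fst z"])
  then have "(norm (lin_vec z))\<^sup>2 = (norm a)\<^sup>2 * (norm a)\<^sup>2 * (norm a)\<^sup>2 + snd z * snd z * (norm a)\<^sup>2"
    by (simp only: dot_square_norm norm_heis_J)
  then show ?thesis
    by (simp add: hnorm4_def a_def power2_eq_square power4_eq_xxxx algebra_simps)
qed

lemma norm_lin_vec_le: "norm (lin_vec z) \<le> koranyi_norm z ^ 3"
proof -
  have "(norm (lin_vec z))\<^sup>2 \<le> (koranyi_norm z)\<^sup>2 * koranyi_norm z ^ 4"
    unfolding norm_lin_vec_sq koranyi_norm_pow4
    by (intro mult_right_mono power_mono norm_fst_le) auto
  also have "\<dots> = (koranyi_norm z ^ 3)\<^sup>2"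
    by (simp flip: power_add power_mult)
  finally show ?thesis by (rule power2_le_imp_le) simp
qed

lemma abs_inner_lin_vec_le: "\<bar>fst u \<bullet> lin_vec z\<bar> \<le> koranyi_norm u * koranyi_norm z ^ 3"
  by (rule order_trans[OF Cauchy_Schwarz_ineq2 mult_mono[OF norm_fst_le norm_lin_vec_le]]) auto

lemma abs_inner_fst_le: "\<bar>fst u \<bullet> fst z\<bar> \<le> koranyi_norm u * koranyi_norm z"
  by (rule order_trans[OF Cauchy_Schwarz_ineq2 mult_mono[OF norm_fst_le norm_fst_le]]) auto

lemma abs_symplectic_le: "\<bar>fst u \<bullet> (heis_J *v fst z)\<bar> \<le> koranyi_norm u * koranyi_norm z"
  by (rule order_trans[OF abs_inner_heis_J mult_mono[OF norm_fst_le norm_fst_le]]) auto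

lemma abs_quad_term_le: "\<bar>quad_term u z\<bar> \<le> 12 * (koranyi_norm u)\<^sup>2 * (koranyi_norm z)\<^sup>2"
proof -
  have sq: "x\<^sup>2 \<le> (koranyi_norm u)\<^sup>2 * (koranyi_norm z)\<^sup>2" if "\<bar>x\<bar> \<le> koranyi_norm u * koranyi_norm z" for x
    using power_mono[OF that, of 2] by (simp add: power_mult_distrib)
  have "(norm (fst z))\<^sup>2 * (norm (fst u))\<^sup>2 \<le> (koranyi_norm z)\<^sup>2 * (koranyi_norm u)\<^sup>2"
    by (intro mult_mono power_mono norm_fst_le) auto
  moreover have "\<bar>snd z * snd u\<bar> \<le> (koranyi_norm z)\<^sup>2 * (koranyi_norm u)\<^sup>2"
    unfolding abs_mult by (intro mult_mono abs_snd_le) auto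
  ultimately show ?thesis
    using sq[OF abs_inner_fst_le[of u z]] sq[OF abs_symplectic_le[of u z]]
      zero_le_power2[of "fst u \<bullet> fst z"] zero_le_power2[of "fst u \<bullet> (heis_J *v fst z)"]
      mult_nonneg_nonneg[OF zero_le_power2[of "norm (fst z)"] zero_le_power2[of "norm (fst u)"]]
    unfolding quad_term_def by (simp only: mult.commute[of "(koranyi_norm z)\<^sup>2"] mult.assoc)
qed

lemma abs_cubic_term_le: "\<bar>cubic_term u z\<bar> \<le> 8 * koranyi_norm u ^ 3 * koranyi_norm z"
proof -
  have "\<bar>(fst u \<bullet> fst z) * (norm (fst u))\<^sup>2\<bar> \<le> (koranyi_norm u * koranyi_norm z) * (koranyi_norm u)\<^sup>2"
    unfolding abs_mult by (intro mult_mono abs_inner_fst_le) (auto intro: norm_fst_le power_mono)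
  moreover have "\<bar>snd u * (fst u \<bullet> (heis_J *v fst z))\<bar> \<le> (koranyi_norm u)\<^sup>2 * (koranyi_norm u * koranyi_norm z)"
    unfolding abs_mult by (intro mult_mono abs_snd_le abs_symplectic_le) auto
  ultimately show ?thesis
    unfolding cubic_term_def by (simp add: power2_eq_square power3_eq_cube mult_ac)
qed

section \<open>The space of quadric coefficients\<close>

text \<open>
  The rank-one matrix of \<open>v\<close>. Its inner product with \<open>Q\<close> is the quadratic form of \<open>Q\<close> at \<open>v\<close>, so that
  evaluating a quadric at a point becomes an inner product in a Euclidean space.
\<close>

definition outer :: "real ^ 'm \<Rightarrow> real ^ 'm ^ 'm" where
  "outer v = (\<chi> i j. v $ i * v $ j)"

lemma inner_outer: "A \<bullet> outer v = v \<bullet> (A *v v)" for v :: "real ^ 'm::finite"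
  by (simp add: inner_vec_def outer_def matrix_vector_mult_def sum_distrib_left algebra_simps)

lemma outer_mult: "outer v *v w = (v \<bullet> w) *\<^sub>R v" for v :: "real ^ 'm::finite"
  by (simp add: vec_eq_iff outer_def matrix_vector_mult_def inner_vec_def sum_distrib_left algebra_simps)

lemma inner_outer_outer: "outer v \<bullet> outer w = (v \<bullet> w)\<^sup>2" for v :: "real ^ 'm::finite"
  by (simp add: inner_outer outer_mult power2_eq_square inner_commute)

lemma trace_inner: "trace A = mat 1 \<bullet> A" for A :: "real ^ 'm::finite ^ 'm"
  by (simp add: trace_def inner_vec_def mat_def if_distrib if_distribR sum.delta cong: if_cong)

type_synonym 'n coeffs = "(real ^ ('n + 'n)) \<times> (real ^ ('n + 'n) ^ ('n + 'n)) \<times> real"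

text \<open>
  A triple \<open>(b, Q, T)\<close> is a quadric, and its inner product with \<open>monomials u\<close> is the value of the quadric at \<open>u\<close>.
\<close>

definition monomials :: "'n::finite heis \<Rightarrow> 'n coeffs" where
  "monomials u = (fst u, outer (fst u), snd u)"

text \<open>
  The quadric formed by the terms of degree at most two in \<open>u\<close> of \<open>exp (hnorm4 z - hdist4 u z) - 1\<close>, with
  weight \<open>c\<close> on the linear part. The first summand of the matrix comes from half the square of the
  linear part. The weight is \<open>1 / l\<close> below, since the linear part is of order \<open>l\<close> and the quadratic
  part is of order \<open>l\<^sup>2\<close>, and the expansion is divided by \<open>l\<^sup>2\<close>.
\<close>

definition coeff_vec :: "real \<Rightarrow> 'n::finite heis \<Rightarrow> 'n coeffs" where
  "coeff_vec c z = ((4 * c) *\<^sub>R lin_vec z,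
     8 *\<^sub>R outer (lin_vec z) - 4 *\<^sub>R outer (fst z) - 4 *\<^sub>R outer (heis_J *v fst z)
       - (2 * (norm (fst z))\<^sup>2) *\<^sub>R mat 1,
     2 * snd z)"

lemma monomials_coeff_vec:
  "monomials u \<bullet> coeff_vec c z = c * (4 * (fst u \<bullet> lin_vec z)) + quad_term u z + (4 * (fst u \<bullet> lin_vec z))\<^sup>2 / 2"
proof -
  have "outer (fst u) \<bullet> mat 1 = (norm (fst u))\<^sup>2"
    by (simp add: inner_commute[of "outer (fst u)"] inner_outer power2_norm_eq_inner)
  then show ?thesis
    by (simp add: monomials_def coeff_vec_def quad_term_def inner_diff_right inner_outer_outer power2_eq_square
       algebra_simps)
qed

text \<open>
  The left-hand side is the trace of the matrix part. It depends on \<open>z\<close> only through \<open>\<bar>z\<^sub>H\<bar>\<^sup>2\<close> and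
  \<open>hnorm4 z\<close>, because \<open>lin_vec z\<close> has squared norm \<open>\<bar>z\<^sub>H\<bar>\<^sup>2 hnorm4 z\<close>.
\<close>

lemma trace_coeff_vec:
  fixes z :: "'n::finite heis"
  shows "(0, mat 1, 0) \<bullet> coeff_vec c z = - 2 * (norm (fst z))\<^sup>2 * (2 * CARD('n) + 4 - 4 * hnorm4 z)"
proof -
  have "(mat 1 :: real ^ ('n + 'n) ^ ('n + 'n)) \<bullet> mat 1 = 2 * CARD('n)"
    by (simp add: trace_inner[symmetric] trace_I card_sum)
  then show ?thesis
    by (simp add: coeff_vec_def inner_diff_right inner_outer flip: power2_norm_eq_inner)
       (simp add: norm_lin_vec_sq norm_heis_J algebra_simps)
qed

text \<open>
  The quadrics that vanish on \<open>S\<close> form the orthogonal complement of \<open>monomials ` S\<close>, and the trace is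
  the inner product with \<open>(0, mat 1, 0)\<close>. If this vector is not in the span, its component orthogonal to
  the span is a vanishing quadric with nonzero trace. Symmetrizing the matrix changes neither the
  quadratic form nor the trace.
\<close>

lemma quadric_of_not_in_span:
  fixes S :: "'n::finite heis set"
  assumes "((0, mat 1, 0) :: 'n coeffs) \<notin> span (monomials ` S)"
  shows "\<exists>(b :: real ^ ('n + 'n)) (T :: real) (Q :: real ^ ('n + 'n) ^ ('n + 'n)).
           transpose Q = Q \<and> trace Q \<noteq> 0 \<and> S \<subseteq> heis_quadric b Q T"
proof -
  let ?e = "(0, mat 1, 0) :: 'n coeffs"
  obtain y z where yz: "y \<in> span (monomials ` S)" "\<And>w. w \<in> span (monomials ` S) \<Longrightarrow> orthogonal z w"
    "?e = y + z"
    by (rule orthogonal_subspace_decomp_exists[of "monomials ` S" ?e]) blast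
  obtain b Q T where z: "z = (b, Q, T)" by (cases z)
  have "z \<noteq> 0" using assms yz by auto
  have "?e \<bullet> z = z \<bullet> z"
    using yz(2)[OF yz(1)] unfolding yz(3) by (simp add: inner_add_left orthogonal_def inner_commute[of y z])
  then have "?e \<bullet> z \<noteq> 0" using \<open>z \<noteq> 0\<close> by simp
  then have tr: "trace Q \<noteq> 0" by (simp add: z trace_inner)
  have eq: "b \<bullet> fst u + fst u \<bullet> (Q *v fst u) + T * snd u = 0" if "u \<in> S" for u
    using yz(2)[of "monomials u"] that by (simp add: span_base orthogonal_def z monomials_def inner_outer)
  define P where "P = (1/2) *\<^sub>R (Q + transpose Q)"
  have "transpose P = P"
    by (simp add: P_def transpose_def vec_eq_iff)
  moreover have "trace P = trace Q"
    by (simp add: P_def trace_def transpose_def)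
  moreover have "x \<bullet> (P *v x) = x \<bullet> (Q *v x)" for x
  proof -
    have "x \<bullet> (transpose Q *v x) = x \<bullet> (Q *v x)"
      unfolding transpose_matrix_vector by (subst inner_commute) (rule dot_lmul_matrix)
    then show ?thesis
      by (simp add: P_def matrix_vector_mult_add_rdistrib scaleR_matrix_vector_assoc[symmetric] inner_add_right)
  qed
  ultimately show ?thesis
    using tr eq by (intro exI[of _ b] exI[of _ T] exI[of _ P]) (auto simp: heis_quadric_def)
qed

section \<open>Elementary estimates\<close>

text \<open>
  Powers are dominated by half of the exponential: apply \<open>x \<le> exp x\<close> to \<open>x = (j + 1) / (2 \<alpha> + 1)\<close>. The
  denominator is \<open>2 \<alpha> + 1\<close> so that it is positive also for \<open>\<alpha> = 0\<close>.
\<close>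

lemma summable_exp_poly: "summable (\<lambda>j. exp (- real j) * (real j + 1) ^ \<alpha>)"
proof (rule summable_comparison_test')
  show "summable (\<lambda>j. ((2 * real \<alpha> + 1) ^ \<alpha> * exp (1/2)) * exp (- 1/2) ^ j)"
    by (intro summable_mult summable_geometric) simp
  fix j :: nat
  define c where "c = 2 * real \<alpha> + 1"
  have c: "c > 0" by (simp add: c_def)
  have "(real j + 1) / c \<le> exp ((real j + 1) / c)"
    using exp_ge_add_one_self[of "(real j + 1) / c"] by linarith
  then have "real j + 1 \<le> c * exp ((real j + 1) / c)"
    using c by (simp add: field_simps)
  then have "(real j + 1) ^ \<alpha> \<le> (c * exp ((real j + 1) / c)) ^ \<alpha>"
    by (intro power_mono) auto
  also have "\<dots> = c ^ \<alpha> * exp (real \<alpha> * ((real j + 1) / c))"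
    by (simp add: power_mult_distrib exp_of_nat_mult[symmetric])
  also have "\<dots> \<le> c ^ \<alpha> * exp ((real j + 1) / 2)"
    using c by (intro mult_left_mono) (auto simp: c_def field_simps)
  finally have "exp (- real j) * (real j + 1) ^ \<alpha> \<le> exp (- real j) * (c ^ \<alpha> * exp ((real j + 1) / 2))"
    by (intro mult_left_mono) auto
  also have "\<dots> = c ^ \<alpha> * exp (1/2) * exp (- 1/2) ^ j"
    by (simp add: exp_of_nat_mult[symmetric] exp_add[symmetric] algebra_simps)
      (simp add: field_simps)
  finally show "norm (exp (- real j) * (real j + 1) ^ \<alpha>) \<le> (2 * real \<alpha> + 1) ^ \<alpha> * exp (1/2) * exp (- 1/2) ^ j"
    by (simp add: c_def abs_mult)
qed

text \<open>
  Lets exponentials of cubic expressions in the norm be absorbed by three quarters of the exponent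
  of the Gaussian \<open>exp (- hnorm4 z)\<close>, at the price of a constant factor.
\<close>

lemma cubic_le_quartic:
  fixes A :: real assumes "0 \<le> A"
  shows "\<exists>B. \<forall>r\<ge>0. A * (1 + r) ^ 3 \<le> B + 3 / 4 * r ^ 4"
proof (intro exI allI impI)
  fix r :: real assume r: "0 \<le> r"
  define c where "c = 1 + 32 / 3 * A"
  have c: "c \<ge> 1" using assms by (simp add: c_def)
  show "A * (1 + r) ^ 3 \<le> A * (1 + c) ^ 3 + 3 / 4 * r ^ 4"
  proof (cases "r \<le> c")
    case True
    then have "A * (1 + r) ^ 3 \<le> A * (1 + c) ^ 3"
      using r assms by (intro mult_left_mono power_mono) auto
    then show ?thesis using r by (simp add: add_increasing2)
  next
    case False
    then have "A * (1 + r) ^ 3 \<le> A * (2 * r) ^ 3"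
      using r c assms by (intro mult_left_mono power_mono) auto
    also have "\<dots> = 3/4 * (32/3 * A) * r ^ 3" by (simp add: power_mult_distrib)
    also have "\<dots> \<le> 3/4 * r * r ^ 3"
      using r False by (intro mult_right_mono mult_left_mono) (auto simp: c_def)
    finally have "A * (1 + r) ^ 3 \<le> 3 / 4 * r ^ 4" by (simp add: power4_eq_xxxx power3_eq_cube)
    then show ?thesis using c assms by (simp add: add_increasing)
  qed
qed

lemma exp_taylor2_bound: "\<bar>exp w - 1 - w - w\<^sup>2 / 2\<bar> \<le> \<bar>w\<bar> ^ 3 * exp \<bar>w\<bar>" for w :: real
proof -
  obtain t where t: "\<bar>t\<bar> \<le> \<bar>w\<bar>" "exp w = (\<Sum>m<3. w ^ m / fact m) + exp t / fact 3 * w ^ 3"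
    using Maclaurin_exp_le[of w 3] by blast
  have "exp w - 1 - w - w\<^sup>2 / 2 = exp t / 6 * w ^ 3"
    by (subst t(2)) (simp add: eval_nat_numeral fact_numeral)
  then have "\<bar>exp w - 1 - w - w\<^sup>2 / 2\<bar> = \<bar>w\<bar> ^ 3 * (exp t / 6)"
    by (simp only: abs_mult power_abs abs_divide abs_exp_cancel abs_numeral mult.commute)
  also have "\<dots> \<le> \<bar>w\<bar> ^ 3 * exp \<bar>w\<bar>"
  proof (rule mult_left_mono)
    have "exp t \<le> exp \<bar>w\<bar>" using t(1) by simp
    then show "exp t / 6 \<le> exp \<bar>w\<bar>" using exp_gt_zero[of t] by linarith
  qed simp
  finally show ?thesis .
qed

lemma power_gauss_bound: "\<exists>C. \<forall>r\<ge>0. r ^ k * exp (- (r ^ 4)) \<le> (C :: real) * exp (- (r ^ 4 / 4))" for k :: nat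
proof -
  obtain B where B: "\<And>r::real. 0 \<le> r \<Longrightarrow> real k * (1 + r) ^ 3 \<le> B + 3 / 4 * r ^ 4"
    using cubic_le_quartic[of "real k"] by auto
  show ?thesis
  proof (intro exI allI impI)
    fix r :: real assume r: "0 \<le> r"
    have "r ^ k \<le> exp r ^ k"
      using r exp_ge_add_one_self[of r] by (intro power_mono) linarith+
    also have "\<dots> = exp (real k * r)" by (simp add: exp_of_nat_mult)
    also have "\<dots> \<le> exp (B + 3 / 4 * r ^ 4)"
    proof -
      have "real k * r \<le> real k * (1 + r) ^ 3"
        using r by (intro mult_left_mono) (auto simp: power3_eq_cube algebra_simps)
      then show ?thesis using B[OF r] by simp
    qed
    finally have "r ^ k * exp (- (r ^ 4)) \<le> exp (B + 3 / 4 * r ^ 4) * exp (- (r ^ 4))"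
      by (rule mult_right_mono) simp
    also have "\<dots> = exp B * exp (- (r ^ 4 / 4))" by (simp flip: exp_add)
    finally show "r ^ k * exp (- (r ^ 4)) \<le> exp B * exp (- (r ^ 4 / 4))" .
  qed
qed

text \<open>
  The first-order term in \<open>h\<close> is the derivative of \<open>\<theta> ^ p * exp (- \<theta> ^ 4 * x)\<close> at \<open>\<theta> = 1\<close>. The
  bound follows from Bernoulli's inequality for the power and from \<open>1 + y \<le> exp y\<close> for the exponential.
\<close>

lemma gauss_dilation_step:
  fixes h x :: real
  assumes "0 \<le> h" "real p * h \<le> 1" "4 \<le> p" "0 \<le> x"
  shows "exp (- x) - (1 - h) ^ p * exp (- ((1 - h) ^ 4 * x))
    \<le> exp (- x) * (h * (real p - 4 * x) + (6 + 4 * real p) * h\<^sup>2 * x)"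
proof -
  have "4 * h \<le> real p * h" using assms by (intro mult_right_mono) auto
  then have h4: "h \<le> 1 / 4" using assms by linarith
  have b: "1 - real p * h \<le> (1 - h) ^ p"
    using Bernoulli_inequality[of "- h" p] h4 by simp
  have "1 - (1 - h) ^ 4 = 4 * h - 6 * h\<^sup>2 + h ^ 3 * (4 - h)"
    by (simp add: power2_eq_square power3_eq_cube power4_eq_xxxx algebra_simps)
  moreover have "0 \<le> h ^ 3 * (4 - h)" using assms h4 by simp
  ultimately have c: "4 * h - 6 * h\<^sup>2 \<le> 1 - (1 - h) ^ 4" by linarith
  have "h\<^sup>2 \<le> h / 4" using h4 assms(1) mult_left_mono[of h "1/4" h] by (simp add: power2_eq_square)
  then have c0: "0 \<le> 4 * h - 6 * h\<^sup>2" using assms by linarith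
  have "1 + (4 * h - 6 * h\<^sup>2) * x \<le> 1 + (1 - (1 - h) ^ 4) * x"
    using c assms by (intro add_left_mono mult_right_mono)
  also have "\<dots> \<le> exp ((1 - (1 - h) ^ 4) * x)" by (rule exp_ge_add_one_self)
  finally have d: "1 + (4 * h - 6 * h\<^sup>2) * x \<le> exp ((1 - (1 - h) ^ 4) * x)" .
  have "(1 - real p * h) * (1 + (4 * h - 6 * h\<^sup>2) * x) \<le> (1 - h) ^ p * exp ((1 - (1 - h) ^ 4) * x)"
    using b d c0 assms h4 by (intro mult_mono) auto
  moreover have "(1 - real p * h) * (1 + (4 * h - 6 * h\<^sup>2) * x) =
     1 - (h * (real p - 4 * x) + (6 + 4 * real p) * h\<^sup>2 * x) + 6 * real p * h ^ 3 * x"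
    by (simp add: power2_eq_square power3_eq_cube algebra_simps)
  moreover have "0 \<le> 6 * real p * h ^ 3 * x" using assms by simp
  ultimately have "1 - (1 - h) ^ p * exp ((1 - (1 - h) ^ 4) * x)
      \<le> h * (real p - 4 * x) + (6 + 4 * real p) * h\<^sup>2 * x" by linarith
  then have "exp (- x) * (1 - (1 - h) ^ p * exp ((1 - (1 - h) ^ 4) * x))
      \<le> exp (- x) * (h * (real p - 4 * x) + (6 + 4 * real p) * h\<^sup>2 * x)" by simp
  moreover have "exp (- x) * (1 - (1 - h) ^ p * exp ((1 - (1 - h) ^ 4) * x))
      = exp (- x) - (1 - h) ^ p * (exp (- x) * exp ((1 - (1 - h) ^ 4) * x))"
    by (simp add: right_diff_distrib)
  moreover have "exp (- x) * exp ((1 - (1 - h) ^ 4) * x) = exp (- ((1 - h) ^ 4 * x))"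
    by (simp add: algebra_simps flip: exp_add)
  ultimately show ?thesis by simp
qed

section \<open>Measurability and the support of a measure\<close>

lemma borel_measurable_hdist4 [measurable]: "hdist4 u \<in> borel_measurable borel"
  using continuous_hdist4[of UNIV u] by (rule borel_measurable_continuous_onI)

lemma borel_measurable_hnorm4 [measurable]: "hnorm4 \<in> borel_measurable borel"
  using continuous_hnorm4[of UNIV] by (rule borel_measurable_continuous_onI)

lemma measurable_dilate [measurable]: "dilate l \<in> measurable borel borel"
  using continuous_dilate[of UNIV l] by (rule borel_measurable_continuous_onI)

lemma continuous_outer [continuous_intros]:
  "continuous_on A f \<Longrightarrow> continuous_on A (\<lambda>x. outer (f x :: real ^ 'm::finite))"
  unfolding outer_def by (intro continuous_intros continuous_on_vec_lambda)

lemma continuous_lin_vec [continuous_intros]: "continuous_on A lin_vec"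
  unfolding lin_vec_def by (intro continuous_intros)

lemma continuous_coeff_vec [continuous_intros]: "continuous_on A (coeff_vec c)"
  unfolding coeff_vec_def by (intro continuous_intros)

lemma borel_measurable_coeff_vec [measurable]: "coeff_vec c \<in> borel_measurable borel"
  by (intro borel_measurable_continuous_onI continuous_coeff_vec)

lemma open_compl_msupp: "open (- msupp M)"
proof -
  have "- msupp M = \<Union>{U. open U \<and> emeasure M U = 0}"
    by (auto simp: msupp_def)
  then show ?thesis by (simp add: open_Union)
qed

text \<open>
  The complement of the support is the union of all open null sets; by the Lindelof property countably many
  of them suffice.
\<close>

lemma emeasure_compl_msupp:
  fixes M :: "'a::second_countable_topology measure"
  assumes [simp]: "sets M = sets borel"
  shows "emeasure M (- msupp M) = 0"
proof -
  have eq: "- msupp M = \<Union>{U. open U \<and> emeasure M U = 0}"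
    by (auto simp: msupp_def)
  obtain F where F: "F \<subseteq> {U. open U \<and> emeasure M U = 0}" "countable F"
      "\<Union>F = \<Union>{U. open U \<and> emeasure M U = 0}"
    by (rule Lindelof[of "{U. open U \<and> emeasure M U = 0}"]) auto
  have "(\<Union>U\<in>F. U) \<in> null_sets M"
    using F(1) by (intro null_sets_UN' F(2)) (auto simp: null_sets_def)
  then show ?thesis unfolding eq using F(3) by auto
qed

section \<open>Gaussian integrals of a uniform measure\<close>

text \<open>
  The factor \<open>l ^ \<alpha>\<close> compensates for the growth of \<open>\<mu>\<close>: it makes the integrals of a fixed rapidly decaying
  function bounded uniformly in the scale \<open>l\<close>.
\<close>

definition scaled_integral :: "'n::finite heis measure \<Rightarrow> nat \<Rightarrow> real \<Rightarrow> ('n heis \<Rightarrow> real) \<Rightarrow> real" where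
  "scaled_integral \<mu> \<alpha> l g = l ^ \<alpha> * (\<integral>z. g (dilate l z) \<partial>\<mu>)"

locale heis_uniform_measure =
  fixes \<mu> :: "'n::finite heis measure" and \<alpha> :: nat
  assumes unif: "heis_uniform (real \<alpha>) \<mu>" and pos: "1 \<le> \<alpha>"
begin

lemma sets_uniform [measurable_cong]: "sets \<mu> = sets borel"
  using unif by (simp add: heis_uniform_def radon_measure_def)

lemma space_uniform [simp]: "space \<mu> = UNIV"
  using sets_eq_imp_space_eq[OF sets_uniform] by simp

lemma zero_in_msupp: "0 \<in> msupp \<mu>"
  using unif by (simp add: heis_uniform_def)

lemma emeasure_koranyi_cball:
  "u \<in> msupp \<mu> \<Longrightarrow> 0 < r \<Longrightarrow> emeasure \<mu> (koranyi_cball u r) = ennreal (r ^ \<alpha>)"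
  using unif by (simp add: heis_uniform_def powr_realpow)

lemma emeasure_hdist4_le:
  assumes "u \<in> msupp \<mu>" "0 < c"
  shows "emeasure \<mu> {z. hdist4 u z \<le> c} = ennreal (c powr (real \<alpha> / 4))"
proof -
  define r where "r = c powr (1/4)"
  have r: "r > 0" "r ^ 4 = c" "r ^ \<alpha> = c powr (real \<alpha> / 4)"
    using assms(2) by (auto simp: r_def powr_powr simp flip: powr_realpow)
  have "{z. hdist4 u z \<le> c} = koranyi_cball u r"
    using r by (auto simp: mem_koranyi_cball)
  then show ?thesis
    using emeasure_koranyi_cball[OF assms(1) r(1)] r by simp
qed

lemma emeasure_hdist4_le_nonpos:
  assumes "u \<in> msupp \<mu>" "c \<le> 0"
  shows "emeasure \<mu> {z. hdist4 u z \<le> c} = 0"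
proof (rule ccontr)
  let ?m = "emeasure \<mu> {z. hdist4 u z \<le> c}"
  assume nz: "?m \<noteq> 0"
  have le: "?m \<le> ennreal (e powr (real \<alpha> / 4))" if "0 < e" for e
  proof -
    have "?m \<le> emeasure \<mu> {z. hdist4 u z \<le> e}"
      using assms that by (intro emeasure_mono) auto
    then show ?thesis using emeasure_hdist4_le[OF assms(1) that] by simp
  qed
  obtain y where y: "?m = ennreal y" "0 \<le> y"
    using le[of 1] by (cases ?m) (auto simp: top_unique)
  with nz have "y > 0" by (auto simp: less_le)
  have "y \<le> ((y/2) powr (4 / real \<alpha>)) powr (real \<alpha> / 4)"
    using le[of "(y/2) powr (4 / real \<alpha>)"] y \<open>y > 0\<close> by (simp add: ennreal_le_iff)
  also have "\<dots> = y / 2" using pos \<open>y > 0\<close> by (simp add: powr_powr)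
  finally show False using \<open>y > 0\<close> by simp
qed

text \<open>
  The law of the distance to a point of the support is determined by the masses of the balls about
  that point, hence does not depend on the point.
\<close>

lemma distr_hdist4:
  assumes "u \<in> msupp \<mu>" "v \<in> msupp \<mu>"
  shows "distr \<mu> borel (hdist4 u) = distr \<mu> borel (hdist4 v)"
proof (rule measure_eqI_generator_eq[where E = "range atMost" and \<Omega> = UNIV and A = "\<lambda>i. {..real i}"])
  have em: "emeasure (distr \<mu> borel (hdist4 w)) {..c} =
      (if 0 < c then ennreal (c powr (real \<alpha> / 4)) else 0)" if "w \<in> msupp \<mu>" for w c
  proof -
    have "emeasure (distr \<mu> borel (hdist4 w)) {..c} = emeasure \<mu> {z. hdist4 w z \<le> c}"
      by (subst emeasure_distr) (auto simp: vimage_def)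
    then show ?thesis
      using emeasure_hdist4_le[OF that, of c] emeasure_hdist4_le_nonpos[OF that, of c] by auto
  qed
  show "Int_stable (range (atMost :: real \<Rightarrow> real set))"
    by (auto simp: Int_stable_def)
  show "emeasure (distr \<mu> borel (hdist4 u)) X = emeasure (distr \<mu> borel (hdist4 v)) X"
    if "X \<in> range atMost" for X
    using that em[OF assms(1)] em[OF assms(2)] by auto
  show "emeasure (distr \<mu> borel (hdist4 u)) {..real i} \<noteq> \<infinity>" for i
    using em[OF assms(1)] by auto
  show "(\<Union>i. {..real i}) = UNIV"
    using real_arch_simple by auto
qed (auto simp: borel_eq_atMost)

lemma gauss_independent_of_center:
  assumes "u \<in> msupp \<mu>"
  shows "(\<integral>z. exp (- (s * hdist4 u z)) \<partial>\<mu>) = (\<integral>z. exp (- (s * hnorm4 z)) \<partial>\<mu>)"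
    and "integrable \<mu> (\<lambda>z. exp (- (s * hdist4 u z))) \<longleftrightarrow> integrable \<mu> (\<lambda>z. exp (- (s * hnorm4 z)))"
proof -
  have [measurable]: "hdist4 w \<in> borel_measurable \<mu>" for w by measurable
  have eq: "distr \<mu> borel (hdist4 u) = distr \<mu> borel hnorm4"
    using distr_hdist4[OF assms zero_in_msupp] by (simp add: hdist4_0[abs_def])
  have "(\<integral>x. exp (- (s * x)) \<partial>distr \<mu> borel (hdist4 u)) = (\<integral>x. exp (- (s * x)) \<partial>distr \<mu> borel hnorm4)"
    by (simp only: eq)
  then show "(\<integral>z. exp (- (s * hdist4 u z)) \<partial>\<mu>) = (\<integral>z. exp (- (s * hnorm4 z)) \<partial>\<mu>)"
    by (simp add: integral_distr)
  have "integrable (distr \<mu> borel (hdist4 u)) (\<lambda>x. exp (- (s * x))) \<longleftrightarrow> integrable (distr \<mu> borel hnorm4) (\<lambda>x. exp (- (s * x)))"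
    by (simp only: eq)
  then show "integrable \<mu> (\<lambda>z. exp (- (s * hdist4 u z))) \<longleftrightarrow> integrable \<mu> (\<lambda>z. exp (- (s * hnorm4 z)))"
    by (simp add: integrable_distr_eq)
qed

text \<open>
  Cut the space into the layers \<open>j \<le> s * hnorm4 z \<le> j + 1\<close> and bound the mass of each by that of the ball
  containing it.
\<close>

lemma nn_integral_gauss_le:
  assumes "0 < s"
  shows "(\<integral>\<^sup>+z. ennreal (exp (- (s * hnorm4 z))) \<partial>\<mu>)
    \<le> ennreal (s powr (- real \<alpha> / 4) * (\<Sum>j. exp (- real j) * (real j + 1) ^ \<alpha>))"
proof -
  let ?A = "\<lambda>j. {z. hnorm4 z \<le> (real j + 1) / s}"
  let ?f = "\<lambda>j z. ennreal (exp (- real j)) * indicator (?A j) z"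
  have [measurable]: "?A j \<in> sets \<mu>" for j
    by measurable
  have term_le: "f j \<le> suminf f" for f :: "nat \<Rightarrow> ennreal" and j
    using sum_le_suminf[OF summableI, of "{j}" f] by simp
  have "ennreal (exp (- (s * hnorm4 z))) \<le> (\<Sum>j. ?f j z)" for z
  proof -
    define j where "j = nat \<lfloor>s * hnorm4 z\<rfloor>"
    have "0 \<le> s * hnorm4 z" using assms by simp
    then have j: "real j \<le> s * hnorm4 z" "s * hnorm4 z \<le> real j + 1"
      unfolding j_def by linarith+
    then have "z \<in> ?A j" using assms by (simp add: field_simps)
    then have "ennreal (exp (- (s * hnorm4 z))) \<le> ?f j z"
      using j by (simp add: ennreal_leI)
    also have "\<dots> \<le> (\<Sum>j. ?f j z)"
      by (rule term_le)
    finally show ?thesis .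
  qed
  then have "(\<integral>\<^sup>+z. ennreal (exp (- (s * hnorm4 z))) \<partial>\<mu>) \<le> (\<integral>\<^sup>+z. (\<Sum>j. ?f j z) \<partial>\<mu>)"
    by (intro nn_integral_mono) auto
  also have "\<dots> = (\<Sum>j. \<integral>\<^sup>+z. ?f j z \<partial>\<mu>)"
    by (rule nn_integral_suminf) measurable
  also have "\<dots> = (\<Sum>j. ennreal (exp (- real j)) * emeasure \<mu> (?A j))"
    by (simp add: nn_integral_cmult_indicator)
  also have "\<dots> \<le> (\<Sum>j. ennreal (s powr (- real \<alpha> / 4) * (exp (- real j) * (real j + 1) ^ \<alpha>)))"
  proof (rule suminf_le[OF _ summableI summableI])
    fix j
    have "emeasure \<mu> (?A j) = ennreal (((real j + 1) / s) powr (real \<alpha> / 4))"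
      using emeasure_hdist4_le[OF zero_in_msupp, of "(real j + 1) / s"] assms by (simp add: hdist4_0)
    also have "((real j + 1) / s) powr (real \<alpha> / 4) = (real j + 1) powr (real \<alpha> / 4) * s powr (- real \<alpha> / 4)"
      using assms by (simp add: powr_divide powr_minus_divide)
    also have "(real j + 1) powr (real \<alpha> / 4) \<le> (real j + 1) powr real \<alpha>"
      by (intro powr_mono) auto
    also have "(real j + 1) powr real \<alpha> = (real j + 1) ^ \<alpha>"
      by (simp add: powr_realpow)
    finally have "emeasure \<mu> (?A j) \<le> ennreal ((real j + 1) ^ \<alpha> * s powr (- real \<alpha> / 4))"
      by (simp add: mult_right_mono ennreal_leI)
    then have "ennreal (exp (- real j)) * emeasure \<mu> (?A j)
        \<le> ennreal (exp (- real j)) * ennreal ((real j + 1) ^ \<alpha> * s powr (- real \<alpha> / 4))"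
      by (rule mult_left_mono) simp
    also have "\<dots> = ennreal (s powr (- real \<alpha> / 4) * (exp (- real j) * (real j + 1) ^ \<alpha>))"
      by (simp add: ennreal_mult[symmetric] mult_ac)
    finally show "ennreal (exp (- real j)) * emeasure \<mu> (?A j)
      \<le> ennreal (s powr (- real \<alpha> / 4) * (exp (- real j) * (real j + 1) ^ \<alpha>))" .
  qed
  also have "\<dots> = ennreal (\<Sum>j. s powr (- real \<alpha> / 4) * (exp (- real j) * (real j + 1) ^ \<alpha>))"
    by (rule suminf_ennreal2) (auto intro!: summable_mult summable_exp_poly)
  also have "\<dots> = ennreal (s powr (- real \<alpha> / 4) * (\<Sum>j. exp (- real j) * (real j + 1) ^ \<alpha>))"
    by (simp add: suminf_mult summable_exp_poly)
  finally show ?thesis .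
qed

lemma integrable_gauss: "0 < s \<Longrightarrow> integrable \<mu> (\<lambda>z. exp (- (s * hnorm4 z)))"
  using nn_integral_gauss_le[of s]
  by (intro integrableI_nonneg) (auto simp: top.not_eq_extremum[symmetric] top_unique)

lemma scaled_integral_bound:
  "\<exists>M\<ge>0. \<forall>l>0. \<forall>g\<in>borel_measurable borel. \<forall>C. (\<forall>z. \<bar>g z\<bar> \<le> C * exp (- (hnorm4 z / 4))) \<longrightarrow>
     integrable \<mu> (\<lambda>z. g (dilate l z)) \<and> \<bar>scaled_integral \<mu> \<alpha> l g\<bar> \<le> C * M"
proof -
  define K where "K = (\<Sum>j. exp (- real j) * (real j + 1) ^ \<alpha>)"
  have K: "0 \<le> K" unfolding K_def by (intro suminf_nonneg summable_exp_poly) auto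
  define M where "M = 4 powr (real \<alpha> / 4) * K"
  have "integrable \<mu> (\<lambda>z. g (dilate l z)) \<and> \<bar>scaled_integral \<mu> \<alpha> l g\<bar> \<le> C * M"
    if l: "0 < l" and g [measurable]: "g \<in> borel_measurable borel"
      and bd: "\<And>z. \<bar>g z\<bar> \<le> C * exp (- (hnorm4 z / 4))" for l g C
  proof -
    define s where "s = l ^ 4 / 4"
    have s: "s > 0" using l by (simp add: s_def)
    have "0 \<le> C * exp (- (hnorm4 (0 :: 'n heis) / 4))" using bd[of 0] by linarith
    then have C: "0 \<le> C" by (simp add: zero_le_mult_iff)
    have bd': "\<bar>g (dilate l z)\<bar> \<le> C * exp (- (s * hnorm4 z))" for z
      using bd[of "dilate l z"] by (simp add: hnorm4_dilate s_def)
    have int: "integrable \<mu> (\<lambda>z. C * exp (- (s * hnorm4 z)))"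
      using integrable_gauss[OF s] by simp
    have intg: "integrable \<mu> (\<lambda>z. g (dilate l z))"
      by (rule Bochner_Integration.integrable_bound[OF int]) (use bd' C in \<open>auto simp: abs_mult\<close>)
    have "(\<integral>z. exp (- (s * hnorm4 z)) \<partial>\<mu>) = enn2real (\<integral>\<^sup>+z. ennreal (exp (- (s * hnorm4 z))) \<partial>\<mu>)"
      by (rule integral_eq_nn_integral) auto
    also have "\<dots> \<le> s powr (- real \<alpha> / 4) * K"
      using nn_integral_gauss_le[OF s] K unfolding K_def[symmetric] by (intro enn2real_leI) auto
    also have "s powr (- real \<alpha> / 4) = 4 powr (real \<alpha> / 4) / l ^ \<alpha>"
    proof -
      have "s powr (- real \<alpha> / 4) = (l powr 4) powr (- real \<alpha> / 4) / 4 powr (- real \<alpha> / 4)"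
        using l by (simp add: s_def powr_divide)
      also have "\<dots> = 4 powr (real \<alpha> / 4) / l ^ \<alpha>"
        unfolding powr_powr using l by (simp add: powr_minus_divide powr_realpow)
      finally show ?thesis .
    qed
    finally have G: "l ^ \<alpha> * (\<integral>z. exp (- (s * hnorm4 z)) \<partial>\<mu>) \<le> M"
      using l by (simp add: M_def field_simps)
    have "\<bar>\<integral>z. g (dilate l z) \<partial>\<mu>\<bar> \<le> (\<integral>z. \<bar>g (dilate l z)\<bar> \<partial>\<mu>)"
      using integral_norm_bound[of \<mu> "\<lambda>z. g (dilate l z)"] by simp
    also have "\<dots> \<le> (\<integral>z. C * exp (- (s * hnorm4 z)) \<partial>\<mu>)"
      using intg int bd' by (intro integral_mono) auto
    finally have "\<bar>scaled_integral \<mu> \<alpha> l g\<bar> \<le> l ^ \<alpha> * (C * (\<integral>z. exp (- (s * hnorm4 z)) \<partial>\<mu>))"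
      using l by (simp add: scaled_integral_def abs_mult)
    also have "\<dots> \<le> C * M"
      using mult_left_mono[OF G C] by (simp add: mult_ac)
    finally show ?thesis using intg by simp
  qed
  moreover have "0 \<le> M" using K by (simp add: M_def)
  ultimately show ?thesis by blast
qed

lemma sets_koranyi_cball: "0 \<le> r \<Longrightarrow> koranyi_cball u r \<in> sets \<mu>"
proof -
  assume "0 \<le> r"
  then have "koranyi_cball u r = {z. hdist4 u z \<le> r ^ 4}" by (auto simp: mem_koranyi_cball)
  then show ?thesis by simp
qed

lemma sets_msupp: "msupp \<mu> \<in> sets \<mu>"
  using open_compl_msupp[of \<mu>] by (simp add: sets_uniform closed_def borel_closed)

lemma emeasure_Int_msupp: "A \<in> sets \<mu> \<Longrightarrow> emeasure \<mu> (A \<inter> msupp \<mu>) = emeasure \<mu> A"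
proof -
  assume A: "A \<in> sets \<mu>"
  have "- msupp \<mu> \<in> null_sets \<mu>"
    using emeasure_compl_msupp[OF sets_uniform] open_compl_msupp[of \<mu>]
    by (auto simp: null_sets_def sets_uniform)
  then have "emeasure \<mu> (A - (- msupp \<mu>)) = emeasure \<mu> A"
    using A by (rule emeasure_Diff_null_set)
  then show ?thesis by (simp add: Diff_eq)
qed

text \<open>
  Comparison of masses, in the two forms in which uniformity is used in the geometric part: disjoint
  balls in a ball, and balls that cover a ball. Only their traces on the support matter.
\<close>

lemma packing:
  assumes I: "finite I" and p: "\<And>i. i \<in> I \<Longrightarrow> p i \<in> msupp \<mu> \<and> 0 < r i" and u: "u \<in> msupp \<mu>" "0 < R"
    and sub: "\<And>i. i \<in> I \<Longrightarrow> koranyi_cball (p i) (r i) \<inter> msupp \<mu> \<subseteq> koranyi_cball u R"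
    and disj: "disjoint_family_on (\<lambda>i. koranyi_cball (p i) (r i) \<inter> msupp \<mu>) I"
  shows "(\<Sum>i\<in>I. r i ^ \<alpha>) \<le> R ^ \<alpha>"
proof -
  let ?B = "\<lambda>i. koranyi_cball (p i) (r i) \<inter> msupp \<mu>"
  have B: "?B i \<in> sets \<mu>" "emeasure \<mu> (?B i) = ennreal (r i ^ \<alpha>)" if "i \<in> I" for i
    using p[OF that] sets_koranyi_cball[of "r i" "p i"] sets_msupp emeasure_koranyi_cball by (auto simp: emeasure_Int_msupp)
  have "ennreal (\<Sum>i\<in>I. r i ^ \<alpha>) = (\<Sum>i\<in>I. ennreal (r i ^ \<alpha>))"
    using p by (intro sum_ennreal[symmetric] zero_le_power) (auto intro: less_imp_le)
  also have "\<dots> = (\<Sum>i\<in>I. emeasure \<mu> (?B i))" using B by simp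
  also have "\<dots> = emeasure \<mu> (\<Union>i\<in>I. ?B i)"
    using B by (intro sum_emeasure disj I) auto
  also have "\<dots> \<le> emeasure \<mu> (koranyi_cball u R)"
    using sub u sets_koranyi_cball by (intro emeasure_mono) auto
  also have "\<dots> = ennreal (R ^ \<alpha>)" using emeasure_koranyi_cball u by simp
  finally show ?thesis using u by (simp add: ennreal_le_iff)
qed

lemma covering:
  assumes I: "finite I" and p: "\<And>i. i \<in> I \<Longrightarrow> p i \<in> msupp \<mu> \<and> 0 < r i" and u: "u \<in> msupp \<mu>" "0 < R"
    and sub: "koranyi_cball u R \<inter> msupp \<mu> \<subseteq> (\<Union>i\<in>I. koranyi_cball (p i) (r i))"
  shows "R ^ \<alpha> \<le> (\<Sum>i\<in>I. r i ^ \<alpha>)"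
proof -
  have B: "koranyi_cball (p i) (r i) \<in> sets \<mu>" "emeasure \<mu> (koranyi_cball (p i) (r i)) = ennreal (r i ^ \<alpha>)"
    if "i \<in> I" for i
    using p[OF that] sets_koranyi_cball[of "r i" "p i"] emeasure_koranyi_cball by auto
  have "ennreal (R ^ \<alpha>) = emeasure \<mu> (koranyi_cball u R \<inter> msupp \<mu>)"
    using emeasure_koranyi_cball u sets_koranyi_cball[of R u] by (simp add: emeasure_Int_msupp)
  also have "\<dots> \<le> emeasure \<mu> (\<Union>i\<in>I. koranyi_cball (p i) (r i))"
    using sub B I by (intro emeasure_mono) auto
  also have "\<dots> \<le> (\<Sum>i\<in>I. emeasure \<mu> (koranyi_cball (p i) (r i)))"
    using B I by (intro emeasure_subadditive_finite) auto
  also have "\<dots> = (\<Sum>i\<in>I. ennreal (r i ^ \<alpha>))" using B by simp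
  also have "\<dots> = ennreal (\<Sum>i\<in>I. r i ^ \<alpha>)"
    using p by (intro sum_ennreal zero_le_power) (auto intro: less_imp_le)
  finally have "ennreal (R ^ \<alpha>) \<le> ennreal (\<Sum>i\<in>I. r i ^ \<alpha>)" .
  moreover have "0 \<le> (\<Sum>i\<in>I. r i ^ \<alpha>)"
    using p by (intro sum_nonneg zero_le_power) (auto intro: less_imp_le)
  ultimately show ?thesis by (simp add: ennreal_le_iff)
qed

end

section \<open>Second-order expansion of the moment identity\<close>

text \<open>
  By \<open>hdist4_expand_dilate\<close>, at the dilate of \<open>z\<close> by \<open>l\<close> this is \<open>l ^ 4 * (hnorm4 z - hdist4 u z)\<close>.
\<close>

definition gauss_exponent :: "'n::finite heis \<Rightarrow> real \<Rightarrow> 'n heis \<Rightarrow> real" where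
  "gauss_exponent u l z = l * (4 * (fst u \<bullet> lin_vec z)) + l\<^sup>2 * quad_term u z + l ^ 3 * cubic_term u z - l ^ 4 * hnorm4 u"

text \<open>
  Taylor expansion to second order in \<open>l\<close>, with a remainder that is still integrable after the
  exponential factor has been estimated by its absolute value: the exponent is at most cubic in the
  norm of \<open>z\<close> and is absorbed by the Gaussian.
\<close>

lemma gauss_expansion:
  fixes u :: "'n::finite heis"
  shows "\<exists>C. \<forall>l z. 0 < l \<longrightarrow> l \<le> 1 \<longrightarrow>
    \<bar>exp (- hnorm4 z) * (exp (gauss_exponent u l z) - 1)
      - l\<^sup>2 * (exp (- hnorm4 z) * (monomials u \<bullet> coeff_vec (1 / l) z))\<bar> \<le> l ^ 3 * (C * exp (- (hnorm4 z / 4)))"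
proof -
  define U where "U = 1 + koranyi_norm u"
  have U: "1 \<le> U" "koranyi_norm u \<le> U" by (auto simp: U_def)
  define A where "A = 48 * U ^ 4"
  have A: "0 \<le> 4 * A" using U by (simp add: A_def)
  obtain B where B: "\<And>r. 0 \<le> r \<Longrightarrow> 4 * A * (1 + r) ^ 3 \<le> B + 3 / 4 * r ^ 4"
    using cubic_le_quartic[OF A] by blast
  show ?thesis
  proof (intro exI allI impI)
    fix l :: real and z :: "'n heis"
    assume l: "0 < l" "l \<le> 1"
    define r where "r = koranyi_norm z"
    have r: "0 \<le> r" by (simp add: r_def)
    define Y where "Y = A * (1 + r) ^ 3"
    have Y0: "0 \<le> Y" using A r by (simp add: Y_def)
    \<comment> \<open>the constant 48 in A is four times 12, the largest constant in the bounds on the coefficients\<close>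
    have key: "c * koranyi_norm u ^ i * r ^ j \<le> Y / 4" if "c \<le> 12" "0 \<le> c" "i \<le> 4" "j \<le> 3" for c i j
    proof -
      have "c * koranyi_norm u ^ i * r ^ j \<le> 12 * U ^ i * (1 + r) ^ j"
        using that U r by (intro mult_mono power_mono) auto
      also have "\<dots> \<le> 12 * U ^ 4 * (1 + r) ^ 3"
        using that U r by (intro mult_mono power_increasing) auto
      finally show ?thesis by (simp add: Y_def A_def)
    qed
    define w1 w2 w3 w4 where "w1 = 4 * (fst u \<bullet> lin_vec z)" and "w2 = quad_term u z" and "w3 = cubic_term u z"
      and "w4 = - hnorm4 u"
    have w1: "\<bar>w1\<bar> \<le> Y / 4"
      using abs_inner_lin_vec_le[of u z] key[of 4 1 3] by (simp add: w1_def r_def)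
    have w2: "\<bar>w2\<bar> \<le> Y / 4"
      using abs_quad_term_le[of u z] key[of 12 2 2] by (simp add: w2_def r_def)
    have w3: "\<bar>w3\<bar> \<le> Y / 4"
      using abs_cubic_term_le[of u z] key[of 8 3 1] by (simp add: w3_def r_def)
    have w4: "\<bar>w4\<bar> \<le> Y / 4"
      using key[of 1 4 0] by (simp add: w4_def koranyi_norm_pow4)
    define w where "w = gauss_exponent u l z"
    have w: "w = l * w1 + l\<^sup>2 * w2 + l ^ 3 * w3 + l ^ 4 * w4"
      by (simp add: w_def gauss_exponent_def w1_def w2_def w3_def w4_def)
    have term_le: "\<bar>l ^ i * x\<bar> \<le> l ^ j * (Y / 4)" if "\<bar>x\<bar> \<le> Y / 4" "j \<le> i" for i j x
      unfolding abs_mult using that l by (intro mult_mono) (auto intro: power_decreasing)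
    have "\<bar>w\<bar> \<le> l * Y"
      using term_le[OF w1, of 1 1] term_le[OF w2, of 1 2] term_le[OF w3, of 1 3] term_le[OF w4, of 1 4]
      unfolding w by (simp add: algebra_simps)
    then have wY: "\<bar>w\<bar> \<le> l * Y" "\<bar>w\<bar> \<le> Y"
      using mult_left_le_one_le[of Y l] Y0 l by auto
    have d1: "\<bar>w - l * w1\<bar> \<le> l\<^sup>2 * Y"
      using term_le[OF w2, of 2 2] term_le[OF w3, of 2 3] term_le[OF w4, of 2 4] Y0 l
        mult_nonneg_nonneg[of "l\<^sup>2" Y]
      unfolding w by (simp add: algebra_simps)
    have d2: "\<bar>w - l * w1 - l\<^sup>2 * w2\<bar> \<le> l ^ 3 * Y"
      using term_le[OF w3, of 3 3] term_le[OF w4, of 3 4] Y0 l mult_nonneg_nonneg[of "l ^ 3" Y]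
      unfolding w by (simp add: algebra_simps)
    have "\<bar>w + l * w1\<bar> \<le> 2 * (l * Y)"
      using wY(1) term_le[OF w1, of 1 1] Y0 l mult_nonneg_nonneg[of l Y] by (simp add: algebra_simps)
    then have "\<bar>(w - l * w1) * (w + l * w1)\<bar> \<le> (l\<^sup>2 * Y) * (2 * (l * Y))"
      unfolding abs_mult using d1 l Y0 by (intro mult_mono) auto
    then have d3: "\<bar>w\<^sup>2 / 2 - l\<^sup>2 * (w1\<^sup>2 / 2)\<bar> \<le> l ^ 3 * Y\<^sup>2"
      by (simp add: algebra_simps power2_eq_square power3_eq_cube)
    have "\<bar>exp w - 1 - w - w\<^sup>2 / 2\<bar> \<le> (l * Y) ^ 3 * exp Y"
      by (rule order_trans[OF exp_taylor2_bound mult_mono]) (use wY l Y0 in \<open>auto intro: power_mono\<close>)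
    then have d4: "\<bar>exp w - 1 - w - w\<^sup>2 / 2\<bar> \<le> l ^ 3 * (Y ^ 3 * exp Y)"
      by (simp add: power_mult_distrib)
    have mon: "l\<^sup>2 * (monomials u \<bullet> coeff_vec (1 / l) z) = l * w1 + l\<^sup>2 * w2 + l\<^sup>2 * (w1\<^sup>2 / 2)"
      using l by (simp add: monomials_coeff_vec w1_def w2_def power2_eq_square field_simps)
    have "\<bar>(exp w - 1) - l\<^sup>2 * (monomials u \<bullet> coeff_vec (1 / l) z)\<bar>
        \<le> l ^ 3 * Y + l ^ 3 * Y\<^sup>2 + l ^ 3 * (Y ^ 3 * exp Y)"
      using d2 d3 d4 unfolding mon by linarith
    also have "\<dots> = l ^ 3 * (Y + Y\<^sup>2 + Y ^ 3 * exp Y)" by (simp add: algebra_simps)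
    also have "Y + Y\<^sup>2 + Y ^ 3 * exp Y \<le> (1 + Y) ^ 3 * exp Y"
    proof -
      have "1 * (Y + Y\<^sup>2) \<le> exp Y * (Y + Y\<^sup>2)" using Y0 by (intro mult_right_mono) auto
      moreover have "Y + Y\<^sup>2 + Y ^ 3 \<le> (1 + Y) ^ 3" using Y0 by (simp add: power3_eq_cube power2_eq_square algebra_simps)
      then have "exp Y * (Y + Y\<^sup>2 + Y ^ 3) \<le> exp Y * (1 + Y) ^ 3" by simp
      ultimately show ?thesis by (simp add: algebra_simps)
    qed
    also have "\<dots> \<le> exp Y ^ 3 * exp Y"
      using Y0 exp_ge_add_one_self[of Y] by (intro mult_right_mono power_mono) auto
    also have "\<dots> = exp (4 * Y)" by (simp add: exp_of_nat_mult[symmetric] exp_add[symmetric])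
    finally have "\<bar>(exp w - 1) - l\<^sup>2 * (monomials u \<bullet> coeff_vec (1 / l) z)\<bar> \<le> l ^ 3 * exp (4 * Y)"
      using l by (simp add: mult_left_mono)
    then have "exp (- hnorm4 z) * \<bar>(exp w - 1) - l\<^sup>2 * (monomials u \<bullet> coeff_vec (1 / l) z)\<bar>
        \<le> exp (- hnorm4 z) * (l ^ 3 * exp (4 * Y))"
      by (intro mult_left_mono) auto
    also have "\<dots> = l ^ 3 * exp (4 * Y - r ^ 4)"
      by (simp add: r_def koranyi_norm_pow4 exp_diff exp_minus field_simps)
    also have "\<dots> \<le> l ^ 3 * exp (B - r ^ 4 / 4)"
      using B[OF r] l by (intro mult_left_mono) (auto simp: Y_def)
    also have "\<dots> = l ^ 3 * (exp B * exp (- (hnorm4 z / 4)))"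
      by (simp add: r_def koranyi_norm_pow4 flip: exp_add)
    finally have "exp (- hnorm4 z) * \<bar>(exp w - 1) - l\<^sup>2 * (monomials u \<bullet> coeff_vec (1 / l) z)\<bar>
        \<le> l ^ 3 * (exp B * exp (- (hnorm4 z / 4)))" .
    moreover have "exp (- hnorm4 z) * (exp (gauss_exponent u l z) - 1)
      - l\<^sup>2 * (exp (- hnorm4 z) * (monomials u \<bullet> coeff_vec (1 / l) z)) =
       exp (- hnorm4 z) * ((exp w - 1) - l\<^sup>2 * (monomials u \<bullet> coeff_vec (1 / l) z))"
      by (simp add: w_def algebra_simps)
    ultimately show "\<bar>exp (- hnorm4 z) * (exp (gauss_exponent u l z) - 1)
      - l\<^sup>2 * (exp (- hnorm4 z) * (monomials u \<bullet> coeff_vec (1 / l) z))\<bar> \<le> l ^ 3 * (exp B * exp (- (hnorm4 z / 4)))"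
      by (simp add: abs_mult)
  qed
qed

context heis_uniform_measure
begin

text \<open>
  By independence of the centre, the function \<open>F\<close> below has integral zero at every scale, and by
  \<open>gauss_expansion\<close> it differs from \<open>l\<^sup>2\<close> times the quadric by \<open>O(l\<^sup>3)\<close>. Integrability is recorded as well,
  because the next lemma integrates linear combinations.
\<close>

lemma moment_expansion:
  assumes u: "u \<in> msupp \<mu>"
  shows "((\<lambda>l. scaled_integral \<mu> \<alpha> l (\<lambda>z. exp (- hnorm4 z) * (monomials u \<bullet> coeff_vec (1 / l) z))) \<longlongrightarrow> 0) (at_right 0)"
    and "0 < l \<Longrightarrow> l \<le> 1 \<Longrightarrow> integrable \<mu> (\<lambda>z. exp (- hnorm4 (dilate l z)) * (monomials u \<bullet> coeff_vec (1 / l) (dilate l z)))"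
proof -
  obtain C where C: "\<And>l z. 0 < l \<Longrightarrow> l \<le> 1 \<Longrightarrow>
    \<bar>exp (- hnorm4 z) * (exp (gauss_exponent u l z) - 1)
      - l\<^sup>2 * (exp (- hnorm4 z) * (monomials u \<bullet> coeff_vec (1 / l) z))\<bar> \<le> l ^ 3 * (C * exp (- (hnorm4 z / 4)))"
    using gauss_expansion[of u] by blast
  obtain M where M: "0 \<le> M" "\<And>l g C. 0 < l \<Longrightarrow> g \<in> borel_measurable borel \<Longrightarrow>
      (\<And>z. \<bar>g z\<bar> \<le> C * exp (- (hnorm4 z / 4))) \<Longrightarrow>
     integrable \<mu> (\<lambda>z. g (dilate l z)) \<and> \<bar>scaled_integral \<mu> \<alpha> l g\<bar> \<le> C * M"
    using scaled_integral_bound by blast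
  have main: "integrable \<mu> (\<lambda>z. exp (- hnorm4 (dilate l z)) * (monomials u \<bullet> coeff_vec (1 / l) (dilate l z))) \<and>
     \<bar>scaled_integral \<mu> \<alpha> l (\<lambda>z. exp (- hnorm4 z) * (monomials u \<bullet> coeff_vec (1 / l) z))\<bar> \<le> l * (C * M)"
    if l: "0 < l" "l \<le> 1" for l
  proof -
    define F where "F z = exp (- hnorm4 z) * (exp (gauss_exponent u l z) - 1)" for z
    define G where "G z = exp (- hnorm4 z) * (monomials u \<bullet> coeff_vec (1 / l) z)" for z
    have [measurable]: "gauss_exponent u l \<in> borel_measurable borel"
      unfolding gauss_exponent_def quad_term_def cubic_term_def
      by (intro borel_measurable_continuous_onI continuous_intros)
    have [measurable]: "F \<in> borel_measurable borel" "G \<in> borel_measurable borel"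
      unfolding F_def[abs_def] G_def[abs_def] by measurable
    have Fd: "F (dilate l z) = exp (- (l ^ 4 * hdist4 u z)) - exp (- (l ^ 4 * hnorm4 z))" for z
    proof -
      have "gauss_exponent u l (dilate l z) = l ^ 4 * (hnorm4 z - hdist4 u z)"
        unfolding gauss_exponent_def hdist4_expand_dilate ..
      then show ?thesis
        by (simp add: F_def hnorm4_dilate right_diff_distrib exp_diff exp_minus divide_simps)
    qed
    have i1: "integrable \<mu> (\<lambda>z. exp (- (l ^ 4 * hnorm4 z)))"
      using l by (intro integrable_gauss) auto
    then have i2: "integrable \<mu> (\<lambda>z. exp (- (l ^ 4 * hdist4 u z)))"
      using gauss_independent_of_center(2)[OF u] by simp
    have iF: "integrable \<mu> (\<lambda>z. F (dilate l z))" and F0: "(\<integral>z. F (dilate l z) \<partial>\<mu>) = 0"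
      unfolding Fd using i1 i2 gauss_independent_of_center(1)[OF u, of "l ^ 4"] by auto
    have "\<bar>(\<lambda>z. F z - l\<^sup>2 * G z) z\<bar> \<le> (l ^ 3 * C) * exp (- (hnorm4 z / 4))" for z
      using C[OF l, of z] by (simp add: F_def G_def mult_ac)
    from M(2)[OF l(1) _ this] have D: "integrable \<mu> (\<lambda>z. F (dilate l z) - l\<^sup>2 * G (dilate l z))"
      "\<bar>scaled_integral \<mu> \<alpha> l (\<lambda>z. F z - l\<^sup>2 * G z)\<bar> \<le> (l ^ 3 * C) * M"
      by simp_all
    have "integrable \<mu> (\<lambda>z. F (dilate l z) - (F (dilate l z) - l\<^sup>2 * G (dilate l z)))"
      using iF D(1) by (rule Bochner_Integration.integrable_diff)
    then have iG: "integrable \<mu> (\<lambda>z. G (dilate l z))" using l by simp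
    have "scaled_integral \<mu> \<alpha> l (\<lambda>z. F z - l\<^sup>2 * G z) = - (l\<^sup>2 * scaled_integral \<mu> \<alpha> l G)"
      using iF iG F0 by (simp add: scaled_integral_def)
    then have "l\<^sup>2 * \<bar>scaled_integral \<mu> \<alpha> l G\<bar> \<le> l\<^sup>2 * (l * (C * M))"
      using D(2) by (simp add: abs_mult power2_eq_square power3_eq_cube mult_ac)
    then have "\<bar>scaled_integral \<mu> \<alpha> l G\<bar> \<le> l * (C * M)" using l by simp
    then show ?thesis using iG by (simp add: G_def[abs_def])
  qed
  then show "0 < l \<Longrightarrow> l \<le> 1 \<Longrightarrow> integrable \<mu> (\<lambda>z. exp (- hnorm4 (dilate l z)) * (monomials u \<bullet> coeff_vec (1 / l) (dilate l z)))"
    by blast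
  show "((\<lambda>l. scaled_integral \<mu> \<alpha> l (\<lambda>z. exp (- hnorm4 z) * (monomials u \<bullet> coeff_vec (1 / l) z))) \<longlongrightarrow> 0) (at_right 0)"
  proof (rule Lim_null_comparison)
    show "\<forall>\<^sub>F l in at_right 0. norm (scaled_integral \<mu> \<alpha> l (\<lambda>z. exp (- hnorm4 z) * (monomials u \<bullet> coeff_vec (1 / l) z))) \<le> l * (C * M)"
      unfolding eventually_at_right_field using main by (intro exI[of _ 1]) auto
    show "((\<lambda>l. l * (C * M)) \<longlongrightarrow> 0) (at_right 0)"
      by (intro tendsto_mult_left_zero tendsto_ident_at)
  qed
qed

text \<open>
  The coefficient functionals that tend to zero form a subspace, which contains the evaluations at
  the points of the support.
\<close>

lemma trace_tendsto_0:
  assumes "((0, mat 1, 0) :: 'n coeffs) \<in> span (monomials ` msupp \<mu>)"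
  shows "((\<lambda>l. scaled_integral \<mu> \<alpha> l (\<lambda>z. exp (- hnorm4 z) *
     ((norm (fst z))\<^sup>2 * (2 * CARD('n) + 4 - 4 * hnorm4 z)))) \<longlongrightarrow> 0) (at_right 0)"
proof -
  define f where "f v l z = exp (- hnorm4 z) * (v \<bullet> coeff_vec (1 / l) z)" for v :: "'n coeffs" and l z
  define V where "V = {v. (\<forall>l. 0 < l \<longrightarrow> l \<le> 1 \<longrightarrow> integrable \<mu> (\<lambda>z. f v l (dilate l z))) \<and>
    ((\<lambda>l. scaled_integral \<mu> \<alpha> l (f v l)) \<longlongrightarrow> 0) (at_right 0)}"
  have ev: "\<forall>\<^sub>F l in at_right 0. 0 < l \<and> l \<le> (1::real)"
    unfolding eventually_at_right_field by (intro exI[of _ 1]) auto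
  have "subspace V"
  proof (rule subspaceI)
    show "0 \<in> V" by (simp add: V_def f_def scaled_integral_def)
    fix v w assume v: "v \<in> V" and w: "w \<in> V"
    have fadd: "f (v + w) l z = f v l z + f w l z" for l z
      by (simp add: f_def inner_add_left algebra_simps)
    have "((\<lambda>l. scaled_integral \<mu> \<alpha> l (f v l) + scaled_integral \<mu> \<alpha> l (f w l)) \<longlongrightarrow> 0 + 0) (at_right 0)"
      using v w by (intro tendsto_add) (auto simp: V_def)
    moreover have "\<forall>\<^sub>F l in at_right 0. scaled_integral \<mu> \<alpha> l (f v l) + scaled_integral \<mu> \<alpha> l (f w l) = scaled_integral \<mu> \<alpha> l (f (v + w) l)"
      using ev
    proof eventually_elim
      case (elim l)
      then show ?case using v w by (simp add: V_def scaled_integral_def fadd distrib_left)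
    qed
    ultimately have "((\<lambda>l. scaled_integral \<mu> \<alpha> l (f (v + w) l)) \<longlongrightarrow> 0) (at_right 0)"
      by (simp add: tendsto_cong)
    then show "v + w \<in> V" using v w by (simp add: V_def fadd)
  next
    fix c v assume v: "v \<in> V"
    have fs: "f (c *\<^sub>R v) l z = c * f v l z" for l z
      by (simp add: f_def)
    have "scaled_integral \<mu> \<alpha> l (f (c *\<^sub>R v) l) = c * scaled_integral \<mu> \<alpha> l (f v l)" for l
      by (simp add: scaled_integral_def fs)
    then show "c *\<^sub>R v \<in> V" using v
      by (auto simp: V_def fs intro!: tendsto_mult_right_zero)
  qed
  moreover have "monomials ` msupp \<mu> \<subseteq> V"
    using moment_expansion by (auto simp only: V_def f_def[abs_def])
  ultimately have "(0, mat 1, 0) \<in> V"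
    using assms span_minimal by blast
  then have "((\<lambda>l. scaled_integral \<mu> \<alpha> l (f (0, mat 1, 0) l)) \<longlongrightarrow> 0) (at_right 0)"
    by (simp add: V_def)
  then have "((\<lambda>l. (- 1 / 2) * scaled_integral \<mu> \<alpha> l (f (0, mat 1, 0) l)) \<longlongrightarrow> 0) (at_right 0)"
    by (rule tendsto_mult_right_zero)
  moreover have "(- 1 / 2) * scaled_integral \<mu> \<alpha> l (f (0, mat 1, 0) l) = scaled_integral \<mu> \<alpha> l (\<lambda>z. exp (- hnorm4 z) *
     ((norm (fst z))\<^sup>2 * (2 * CARD('n) + 4 - 4 * hnorm4 z)))" for l
  proof -
    have "f (0, mat 1, 0) l z = (- 2) * (exp (- hnorm4 z) *
     ((norm (fst z))\<^sup>2 * (2 * CARD('n) + 4 - 4 * hnorm4 z)))" for z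
      unfolding f_def trace_coeff_vec by simp
    then show ?thesis by (simp only: scaled_integral_def integral_mult_right_zero)
  qed
  ultimately show ?thesis by simp
qed

end

section \<open>Propagation across scales\<close>

text \<open>
  Measures how far \<open>\<mu>\<close> spreads from the vertical axis at scale \<open>1 / l\<close>.
\<close>

definition gauss_width :: "'n::finite heis measure \<Rightarrow> nat \<Rightarrow> real \<Rightarrow> real" where
  "gauss_width \<mu> \<alpha> l = scaled_integral \<mu> \<alpha> l (\<lambda>z. exp (- hnorm4 z) * (norm (fst z))\<^sup>2)"

context heis_uniform_measure
begin

lemma gauss_moment_bound:
  "\<exists>K\<ge>0. \<forall>l>0. integrable \<mu> (\<lambda>z. exp (- hnorm4 (dilate l z)) * (norm (fst (dilate l z)))\<^sup>2 * hnorm4 (dilate l z) ^ j) \<and>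
     scaled_integral \<mu> \<alpha> l (\<lambda>z. exp (- hnorm4 z) * (norm (fst z))\<^sup>2 * hnorm4 z ^ j) \<le> K"
proof -
  obtain M where M: "0 \<le> M" "\<And>l g C. 0 < l \<Longrightarrow> g \<in> borel_measurable borel \<Longrightarrow>
      (\<And>z. \<bar>g z\<bar> \<le> C * exp (- (hnorm4 z / 4))) \<Longrightarrow>
     integrable \<mu> (\<lambda>z. g (dilate l z)) \<and> \<bar>scaled_integral \<mu> \<alpha> l g\<bar> \<le> C * M"
    using scaled_integral_bound by blast
  obtain C where C: "\<And>r::real. 0 \<le> r \<Longrightarrow> r ^ (2 + 4 * j) * exp (- (r ^ 4)) \<le> C * exp (- (r ^ 4 / 4))"
    using power_gauss_bound by blast
  define g where "g z = exp (- hnorm4 z) * (norm (fst z))\<^sup>2 * hnorm4 z ^ j" for z :: "'n heis"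
  have meas: "g \<in> borel_measurable borel"
    unfolding g_def[abs_def] by (intro borel_measurable_continuous_onI continuous_intros)
  have bd: "\<bar>g z\<bar> \<le> C * exp (- (hnorm4 z / 4))" for z
  proof -
    have "\<bar>g z\<bar> = exp (- hnorm4 z) * ((norm (fst z))\<^sup>2 * hnorm4 z ^ j)" by (simp add: g_def)
    also have "\<dots> \<le> exp (- hnorm4 z) * ((koranyi_norm z)\<^sup>2 * hnorm4 z ^ j)"
      by (intro mult_left_mono mult_right_mono power_mono norm_fst_le) auto
    also have "\<dots> = koranyi_norm z ^ (2 + 4 * j) * exp (- (koranyi_norm z ^ 4))"
      by (simp add: power_add power_mult koranyi_norm_pow4 power2_eq_square)
    also have "\<dots> \<le> C * exp (- (hnorm4 z / 4))"
      using C[of "koranyi_norm z"] by (simp add: koranyi_norm_pow4)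
    finally show ?thesis .
  qed
  have "\<bar>C * M\<bar> \<ge> 0" by simp
  moreover have "integrable \<mu> (\<lambda>z. g (dilate l z)) \<and> scaled_integral \<mu> \<alpha> l g \<le> \<bar>C * M\<bar>" if "0 < l" for l
    using M(2)[OF that meas bd] by linarith
  ultimately show ?thesis unfolding g_def[abs_def] by blast
qed

lemma integrable_gauss_width:
  "0 < l \<Longrightarrow> integrable \<mu> (\<lambda>z. exp (- hnorm4 (dilate l z)) * (norm (fst (dilate l z)))\<^sup>2)"
  using gauss_moment_bound[of 0] by auto

text \<open>
  Integrating \<open>gauss_dilation_step\<close> with \<open>p = 2n + 4\<close> gives, for \<open>\<theta> = 1 - h\<close>,
  \<open>G(l) \<le> \<theta> ^ (2n + 2 - \<alpha>) * G(\<theta> l) + h * T(l) + O(h\<^sup>2)\<close> with \<open>T\<close> the integral assumed to vanish in the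
  limit. The exponent is at least one by the bound on \<open>\<alpha>\<close>. Once \<open>h\<close> is fixed so small that the last
  term is at most \<open>h e / 2\<close>, this says that \<open>G(l) - e\<close> contracts by the factor \<open>\<theta>\<close> under \<open>l \<mapsto> \<theta> l\<close>. As \<open>G\<close>
  is bounded along the whole orbit, \<open>G(l) - e \<le> 0\<close>.
\<close>

lemma gauss_width_small:
  assumes tr: "((\<lambda>l. scaled_integral \<mu> \<alpha> l (\<lambda>z. exp (- hnorm4 z) *
     ((norm (fst z))\<^sup>2 * (2 * CARD('n) + 4 - 4 * hnorm4 z)))) \<longlongrightarrow> 0) (at_right 0)"
    and dim: "\<alpha> \<le> 2 * CARD('n) + 1" and e: "0 < e"
  shows "\<exists>d>0. \<forall>l. 0 < l \<longrightarrow> l < d \<longrightarrow> gauss_width \<mu> \<alpha> l \<le> e"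
proof -
  define p where "p = 2 * CARD('n) + 4"
  define T where "T l = scaled_integral \<mu> \<alpha> l (\<lambda>z. exp (- hnorm4 z) *
     ((norm (fst z))\<^sup>2 * (real p - 4 * hnorm4 z)))" for l
  define N where "N l = scaled_integral \<mu> \<alpha> l (\<lambda>z. exp (- hnorm4 z) * (norm (fst z))\<^sup>2 * hnorm4 z ^ 1)" for l
  let ?G = "gauss_width \<mu> \<alpha>"
  obtain K where K: "0 \<le> K" "\<And>l. 0 < l \<Longrightarrow> ?G l \<le> K"
    using gauss_moment_bound[of 0] by (auto simp: gauss_width_def)
  obtain K1 where K1: "0 \<le> K1" "\<And>l. 0 < l \<Longrightarrow> N l \<le> K1"
    and int1: "\<And>l. 0 < l \<Longrightarrow> integrable \<mu> (\<lambda>z. exp (- hnorm4 (dilate l z)) * (norm (fst (dilate l z)))\<^sup>2 * hnorm4 (dilate l z))"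
    using gauss_moment_bound[of 1] by (auto simp: N_def)
  have G0: "0 \<le> ?G l" if "0 < l" for l
    using that by (simp add: gauss_width_def scaled_integral_def)
  have step: "?G l \<le> (1 - h) * ?G ((1 - h) * l) + h * T l + (6 + 4 * real p) * h\<^sup>2 * N l"
    if l: "0 < l" and h: "0 < h" "real p * h \<le> 1" for l h
  proof -
    have "4 * h \<le> real p * h" using h by (intro mult_right_mono) (auto simp: p_def)
    then have h1: "0 < 1 - h" "1 - h \<le> 1" using h by linarith+
    define f0 where "f0 z = exp (- hnorm4 z) * (norm (fst z))\<^sup>2" for z :: "'n heis"
    define f1 where "f1 z = exp (- hnorm4 z) * (norm (fst z))\<^sup>2 * hnorm4 z" for z :: "'n heis"
    have i0: "integrable \<mu> (\<lambda>z. f0 (dilate l z))" if "0 < l" for l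
      using integrable_gauss_width[OF that] by (simp add: f0_def)
    have i1: "integrable \<mu> (\<lambda>z. f1 (dilate l z))"
      using int1[OF l] by (simp add: f1_def)
    have Teq: "T l = real p * scaled_integral \<mu> \<alpha> l f0 - 4 * scaled_integral \<mu> \<alpha> l f1"
    proof -
      have "exp (- hnorm4 z) * ((norm (fst z))\<^sup>2 * (real p - 4 * hnorm4 z)) = real p * f0 z - 4 * f1 z" for z :: "'n heis"
        by (simp add: f0_def f1_def algebra_simps)
      then show ?thesis
        using i0[OF l] i1 unfolding T_def scaled_integral_def by (simp add: right_diff_distrib)
    qed
    have Neq: "N l = scaled_integral \<mu> \<alpha> l f1" by (simp add: N_def f1_def[abs_def])
    have "f0 z - (1 - h) ^ (p - 2) * f0 (dilate (1 - h) z)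
       \<le> (h * real p) * f0 z + ((6 + 4 * real p) * h\<^sup>2 - 4 * h) * f1 z" for z
    proof -
      have pp: "(1 - h) ^ p = (1 - h) ^ (p - 2) * (1 - h)\<^sup>2"
        unfolding power_add[symmetric] by (rule arg_cong[where f = "(^) (1 - h)"]) (simp add: p_def)
      have nf: "(norm (fst (dilate (1 - h) z)))\<^sup>2 = (1 - h)\<^sup>2 * (norm (fst z))\<^sup>2"
        by (simp only: dilate_def fst_conv norm_scaleR power_mult_distrib power2_abs)
      have "(exp (- hnorm4 z) - (1 - h) ^ p * exp (- ((1 - h) ^ 4 * hnorm4 z))) * (norm (fst z))\<^sup>2
        \<le> (exp (- hnorm4 z) * (h * (real p - 4 * hnorm4 z) + (6 + 4 * real p) * h\<^sup>2 * hnorm4 z)) * (norm (fst z))\<^sup>2"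
        by (intro mult_right_mono gauss_dilation_step) (use h in \<open>auto simp: p_def\<close>)
      then show ?thesis
        unfolding pp by (simp add: f0_def f1_def hnorm4_dilate nf algebra_simps)
    qed
    then have "(\<integral>z. f0 (dilate l z) - (1 - h) ^ (p - 2) * f0 (dilate ((1 - h) * l) z) \<partial>\<mu>)
      \<le> (\<integral>z. (h * real p) * f0 (dilate l z) + ((6 + 4 * real p) * h\<^sup>2 - 4 * h) * f1 (dilate l z) \<partial>\<mu>)"
      using i0[OF l] i0[of "(1 - h) * l"] i1 l h1
      by (intro integral_mono) (auto simp flip: dilate_dilate)
    then have "l ^ \<alpha> * ((\<integral>z. f0 (dilate l z) \<partial>\<mu>) - (1 - h) ^ (p - 2) * (\<integral>z. f0 (dilate ((1 - h) * l) z) \<partial>\<mu>))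
      \<le> l ^ \<alpha> * ((h * real p) * (\<integral>z. f0 (dilate l z) \<partial>\<mu>) + ((6 + 4 * real p) * h\<^sup>2 - 4 * h) * (\<integral>z. f1 (dilate l z) \<partial>\<mu>))"
      using i0[OF l] i0[of "(1 - h) * l"] i1 l h1 by (intro mult_left_mono) auto
    moreover have "l ^ \<alpha> * (1 - h) ^ (p - 2) = (1 - h) ^ (p - 2 - \<alpha>) * ((1 - h) * l) ^ \<alpha>"
    proof -
      have "p - 2 = (p - 2 - \<alpha>) + \<alpha>" using dim by (simp add: p_def)
      then have "(1 - h) ^ (p - 2) = (1 - h) ^ (p - 2 - \<alpha>) * (1 - h) ^ \<alpha>"
        by (metis power_add)
      then show ?thesis by (simp add: power_mult_distrib)
    qed
    ultimately have "scaled_integral \<mu> \<alpha> l f0 - (1 - h) ^ (p - 2 - \<alpha>) * scaled_integral \<mu> \<alpha> ((1 - h) * l) f0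
      \<le> h * (real p * scaled_integral \<mu> \<alpha> l f0 - 4 * scaled_integral \<mu> \<alpha> l f1) + (6 + 4 * real p) * h\<^sup>2 * scaled_integral \<mu> \<alpha> l f1"
      unfolding scaled_integral_def right_diff_distrib mult.assoc[symmetric] by (simp add: algebra_simps)
    then have "?G l \<le> (1 - h) ^ (p - 2 - \<alpha>) * ?G ((1 - h) * l) + h * T l + (6 + 4 * real p) * h\<^sup>2 * N l"
      unfolding Teq Neq gauss_width_def f0_def[abs_def, symmetric] by linarith
    moreover have "(1 - h) ^ (p - 2 - \<alpha>) \<le> (1 - h) ^ 1"
      using h1 dim by (intro power_decreasing) (auto simp: p_def)
    then have "(1 - h) ^ (p - 2 - \<alpha>) * ?G ((1 - h) * l) \<le> (1 - h) * ?G ((1 - h) * l)"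
      using h1 l by (intro mult_right_mono G0) auto
    ultimately show ?thesis by linarith
  qed
  define h where "h = min (1 / real p) (e / (2 * ((6 + 4 * real p) * K1 + 1)))"
  have den: "0 < (6 + 4 * real p) * K1 + 1" using K1 by (intro add_nonneg_pos) auto
  have p0: "1 < real p" by (simp add: p_def)
  have h: "0 < h" "real p * h \<le> 1"
  proof -
    show "0 < h" using e den p0 by (simp add: h_def)
    have "real p * h \<le> real p * (1 / real p)" using p0 by (intro mult_left_mono) (auto simp: h_def)
    then show "real p * h \<le> 1" using p0 by simp
  qed
  have "h * ((6 + 4 * real p) * K1) \<le> e / 2"
  proof -
    have "h * ((6 + 4 * real p) * K1 + 1) \<le> e / (2 * ((6 + 4 * real p) * K1 + 1)) * ((6 + 4 * real p) * K1 + 1)"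
      using den by (intro mult_right_mono) (auto simp: h_def)
    also have "\<dots> = e / 2" using den by (simp add: field_simps)
    finally show ?thesis using h by (simp add: distrib_left)
  qed
  then have he: "(6 + 4 * real p) * h\<^sup>2 * N l \<le> h * (e / 2)" if "0 < l" for l
  proof -
    have "(6 + 4 * real p) * h\<^sup>2 * N l \<le> (6 + 4 * real p) * h\<^sup>2 * K1"
      using K1(2)[OF that] by (intro mult_left_mono) auto
    also have "\<dots> = h * (h * ((6 + 4 * real p) * K1))" by (simp add: power2_eq_square)
    also have "\<dots> \<le> h * (e / 2)"
      using \<open>h * ((6 + 4 * real p) * K1) \<le> e / 2\<close> h by (intro mult_left_mono) auto
    finally show ?thesis .
  qed
  have "(T \<longlongrightarrow> 0) (at_right 0)"
    using tr by (simp add: T_def[abs_def] p_def add.commute)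
  then have "\<forall>\<^sub>F l in at_right 0. T l < e / 2"
    using e by (intro order_tendstoD(2)) auto
  then obtain d where d: "0 < d" "\<And>l. 0 < l \<Longrightarrow> l < d \<Longrightarrow> T l < e / 2"
    unfolding eventually_at_right_field by auto
  define th where "th = 1 - h"
  have "h < real p * h" using mult_strict_right_mono[OF p0 h(1)] by simp
  then have "h < 1" using h(2) by (rule less_le_trans)
  then have th: "0 < th" "th < 1" using h by (auto simp: th_def)
  have rec: "?G l - e \<le> th * (?G (th * l) - e)" if "0 < l" "l < d" for l
  proof -
    have "h * T l \<le> h * (e / 2)" using d(2)[OF that] h by (intro mult_left_mono) auto
    then show ?thesis
      using step[OF that(1) h] he[OF that(1)] by (simp add: th_def algebra_simps)
  qed
  have iter: "?G l - e \<le> th ^ j * (?G (th ^ j * l) - e)" if l: "0 < l" "l < d" for l j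
  proof (induction j)
    case (Suc j)
    have "th ^ j * l \<le> 1 * l" using th l by (intro mult_right_mono power_le_one) auto
    then have "th ^ j * l < d" using l by linarith
    then have "?G (th ^ j * l) - e \<le> th * (?G (th * (th ^ j * l)) - e)"
      using th l by (intro rec) auto
    then have "th ^ j * (?G (th ^ j * l) - e) \<le> th ^ j * (th * (?G (th * (th ^ j * l)) - e))"
      using th by (intro mult_left_mono) auto
    with Suc show ?case by (simp add: mult_ac)
  qed simp
  have "?G l \<le> e" if l: "0 < l" "l < d" for l
  proof -
    have "?G l \<le> e + th ^ j * K" for j
    proof -
      have "th ^ j * (?G (th ^ j * l) - e) \<le> th ^ j * K"
        using K(2)[of "th ^ j * l"] th l e by (intro mult_left_mono) auto
      then show ?thesis using iter[OF l, of j] by linarith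
    qed
    moreover have "(\<lambda>j. e + th ^ j * K) \<longlonglongrightarrow> e + 0 * K"
      using th by (intro tendsto_intros LIMSEQ_power_zero) auto
    ultimately show ?thesis
      by (intro LIMSEQ_le_const[where X = "\<lambda>j. e + th ^ j * K"]) auto
  qed
  then show ?thesis using d(1) by blast
qed

end

section \<open>Supports close to the vertical axis\<close>

text \<open>
  On \<open>S\<close>, within distance \<open>R\<close> of the origin, the squared distance agrees with the difference of
  heights up to \<open>e * R\<^sup>2\<close>. It is phrased by means of balls because that is how it meets the measure.
\<close>

definition axis_like :: "'n::finite heis set \<Rightarrow> real \<Rightarrow> real \<Rightarrow> bool" where
  "axis_like S e R \<longleftrightarrow> 0 < R \<and>
     (\<forall>p\<in>S. \<forall>q\<in>S. hnorm4 p \<le> R ^ 4 \<longrightarrow> hnorm4 q \<le> R ^ 4 \<longrightarrow>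
       (\<forall>r\<ge>0. (\<bar>snd p - snd q\<bar> + e * R\<^sup>2 \<le> r\<^sup>2 \<longrightarrow> q \<in> koranyi_cball p r) \<and>
                (q \<in> koranyi_cball p r \<longrightarrow> \<bar>snd p - snd q\<bar> \<le> r\<^sup>2 + e * R\<^sup>2)))"

context heis_uniform_measure
begin

text \<open>
  A point of the support at distance more than \<open>h R\<close> from the axis comes with a ball of radius \<open>h R / 2\<close>
  that stays away from the axis and has mass comparable to \<open>R ^ \<alpha>\<close>. This ball alone contributes a fixed
  positive amount to \<open>gauss_width\<close> at scale \<open>l = 1 / R\<close>.
\<close>

lemma support_near_axis:
  assumes small: "\<And>e. 0 < e \<Longrightarrow> \<exists>l>0. gauss_width \<mu> \<alpha> l \<le> e" and h: "0 < h" "h \<le> 1"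
  shows "\<exists>R>0. \<forall>p\<in>msupp \<mu>. hnorm4 p \<le> R ^ 4 \<longrightarrow> norm (fst p) \<le> h * R"
proof -
  \<comment> \<open>the ball lies where the dilated hnorm4 is at most 2 (3/2)^4, which is less than 81; half of the
    resulting lower bound is taken to get a strict inequality\<close>
  define e where "e = exp (- 81) * (h / 2) ^ (\<alpha> + 2) / 2"
  have "0 < e" using h by (simp add: e_def)
  then obtain l where l: "0 < l" "gauss_width \<mu> \<alpha> l \<le> e" using small by blast
  define R where "R = 1 / l"
  have R: "0 < R" "l * R = 1" using l by (auto simp: R_def)
  have "norm (fst p) \<le> h * R" if p: "p \<in> msupp \<mu>" "hnorm4 p \<le> R ^ 4" for p
  proof (rule ccontr)
    assume "\<not> norm (fst p) \<le> h * R"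
    then have big: "h * R < norm (fst p)" by simp
    define r where "r = h / 2 * R"
    have r: "0 < r" "r \<le> R / 2" using h R by (auto simp: r_def)
    let ?B = "koranyi_cball p r"
    have B: "?B \<in> sets \<mu>" "emeasure \<mu> ?B = ennreal (r ^ \<alpha>)"
      using r sets_koranyi_cball emeasure_koranyi_cball[OF p(1)] by auto
    have low: "exp (- 81) * (h / 2)\<^sup>2 * indicator ?B z \<le> exp (- hnorm4 (dilate l z)) * (norm (fst (dilate l z)))\<^sup>2" for z
    proof (cases "z \<in> ?B")
      case True
      then have d: "hdist4 p z \<le> r ^ 4" using r by (simp add: mem_koranyi_cball)
      have "hnorm4 z \<le> 2 * (R + r) ^ 4" "norm (fst p - fst z) \<le> r"
        using hnorm4_quasi_triangle[OF p(2) d] R r by auto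
      note this(1)
      also have "2 * (R + r) ^ 4 \<le> 2 * (R + R / 2) ^ 4"
        using R r by (intro mult_left_mono power_mono) auto
      also have "\<dots> = (2 * (3 / 2) ^ 4) * R ^ 4" by (simp add: field_simps power4_eq_xxxx)
      also have "\<dots> \<le> 81 * R ^ 4" using R by (intro mult_right_mono) (auto simp: field_simps)
      finally have "l ^ 4 * hnorm4 z \<le> l ^ 4 * (81 * R ^ 4)" by (intro mult_left_mono) auto
      also have "\<dots> = 81 * (l * R) ^ 4" by (simp add: power_mult_distrib)
      finally have q: "hnorm4 (dilate l z) \<le> 81" using R by (simp add: hnorm4_dilate)
      have "r \<le> norm (fst z)"
        using \<open>norm (fst p - fst z) \<le> r\<close> big norm_triangle_sub[of "fst p" "fst z"] by (simp add: r_def)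
      then have "l * r \<le> l * norm (fst z)" using l by (intro mult_left_mono) auto
      moreover have "l * r = h / 2 * (l * R)" by (simp add: r_def)
      ultimately have "h / 2 \<le> norm (fst (dilate l z))" using R l by (simp add: dilate_def)
      then have "(h / 2)\<^sup>2 \<le> (norm (fst (dilate l z)))\<^sup>2" using h by (intro power_mono) auto
      then have "exp (- 81) * (h / 2)\<^sup>2 \<le> exp (- hnorm4 (dilate l z)) * (norm (fst (dilate l z)))\<^sup>2"
        using q by (intro mult_mono) auto
      then show ?thesis using True by simp
    qed simp
    have "exp (- 81) * (h / 2)\<^sup>2 * r ^ \<alpha> = (\<integral>z. exp (- 81) * (h / 2)\<^sup>2 * indicator ?B z \<partial>\<mu>)"
      using B r by (simp add: measure_def)
    also have "\<dots> \<le> (\<integral>z. exp (- hnorm4 (dilate l z)) * (norm (fst (dilate l z)))\<^sup>2 \<partial>\<mu>)"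
    proof (rule integral_mono)
      show "integrable \<mu> (\<lambda>z. exp (- 81) * (h / 2)\<^sup>2 * indicator ?B z)"
        using B by (intro integrable_mult_right integrable_real_indicator) auto
    qed (use low integrable_gauss_width[OF l(1)] in auto)
    finally have "l ^ \<alpha> * (exp (- 81) * (h / 2)\<^sup>2 * r ^ \<alpha>) \<le> gauss_width \<mu> \<alpha> l"
      using l by (simp add: gauss_width_def scaled_integral_def)
    moreover have "l ^ \<alpha> * r ^ \<alpha> = (h / 2 * (l * R)) ^ \<alpha>"
      unfolding power_mult_distrib[symmetric] by (simp add: r_def mult_ac)
    then have "l ^ \<alpha> * (exp (- 81) * (h / 2)\<^sup>2 * r ^ \<alpha>) = exp (- 81) * (h / 2)\<^sup>2 * (h / 2 * (l * R)) ^ \<alpha>"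
      by (simp only: mult.left_commute[of "l ^ \<alpha>"])
    moreover have "exp (- 81) * (h / 2)\<^sup>2 * (h / 2 * (l * R)) ^ \<alpha> = 2 * e"
      using R by (simp add: e_def power2_eq_square)
    ultimately have "2 * e \<le> gauss_width \<mu> \<alpha> l" by linarith
    then show False using l \<open>0 < e\<close> by linarith
  qed
  then show ?thesis using R by blast
qed

lemma axis_like_scale:
  assumes small: "\<And>e. 0 < e \<Longrightarrow> \<exists>l>0. gauss_width \<mu> \<alpha> l \<le> e" and e: "0 < e" "e \<le> 1"
  shows "\<exists>R. axis_like (msupp \<mu>) e R"
proof -
  define h where "h = e / 6"
  have h: "0 < h" "h \<le> 1" using e by (auto simp: h_def)
  obtain R where R: "0 < R" "\<And>p. p \<in> msupp \<mu> \<Longrightarrow> hnorm4 p \<le> R ^ 4 \<Longrightarrow> norm (fst p) \<le> h * R"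
    using support_near_axis[OF small h] by blast
  have "h\<^sup>2 \<le> h" using h by (simp add: power2_eq_square mult_left_le)
  then have "6 * h\<^sup>2 * R\<^sup>2 \<le> e * R\<^sup>2" by (intro mult_right_mono) (auto simp: h_def)
  then have hR: "6 * (h * R)\<^sup>2 \<le> e * R\<^sup>2" by (simp add: power_mult_distrib)
  have "(\<bar>snd p - snd q\<bar> + e * R\<^sup>2 \<le> r\<^sup>2 \<longrightarrow> q \<in> koranyi_cball p r) \<and>
      (q \<in> koranyi_cball p r \<longrightarrow> \<bar>snd p - snd q\<bar> \<le> r\<^sup>2 + e * R\<^sup>2)"
    if pq: "p \<in> msupp \<mu>" "q \<in> msupp \<mu>" "hnorm4 p \<le> R ^ 4" "hnorm4 q \<le> R ^ 4" and r: "0 \<le> r" for p q r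
  proof (intro conjI impI)
    note near = hdist4_near_axis[OF R(2)[OF pq(1,3)] R(2)[OF pq(2,4)]]
    show "q \<in> koranyi_cball p r" if "\<bar>snd p - snd q\<bar> + e * R\<^sup>2 \<le> r\<^sup>2"
    proof -
      have "(\<bar>snd p - snd q\<bar> + 6 * (h * R)\<^sup>2)\<^sup>2 \<le> (r\<^sup>2)\<^sup>2"
        using that hR by (intro power_mono) auto
      then have "hdist4 p q \<le> r ^ 4" using near(1) by (simp flip: power_mult)
      then show ?thesis using r by (simp add: mem_koranyi_cball)
    qed
    show "\<bar>snd p - snd q\<bar> \<le> r\<^sup>2 + e * R\<^sup>2" if "q \<in> koranyi_cball p r"
      using near(2)[OF r] that r hR by (simp add: mem_koranyi_cball)
  qed
  then show ?thesis using R(1) unfolding axis_like_def by blast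
qed

text \<open>
  The heights of the support in the ball of radius \<open>R\<close> lie in \<open>[-R\<^sup>2, R\<^sup>2]\<close>. Cut this into pieces of length
  \<open>R\<^sup>2 / 150\<close>. Since \<open>1/150 + 1/300 = 1/100\<close>, the part of the support over each piece lies in one
  ball of radius \<open>R / 10\<close>, and at most 301 pieces occur. From dimension three on, 301 such balls
  have total mass less than \<open>R ^ \<alpha>\<close>.
\<close>

lemma axis_like_dim_less_3:
  assumes ax: "axis_like (msupp \<mu>) (1/300) R"
  shows "\<alpha> < 3"
proof (rule ccontr)
  assume "\<not> \<alpha> < 3"
  then have a3: "3 \<le> \<alpha>" by simp
  have R: "0 < R" and cov: "\<And>p q r. p \<in> msupp \<mu> \<Longrightarrow> q \<in> msupp \<mu> \<Longrightarrow> hnorm4 p \<le> R ^ 4 \<Longrightarrow>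
      hnorm4 q \<le> R ^ 4 \<Longrightarrow> 0 \<le> r \<Longrightarrow> \<bar>snd p - snd q\<bar> + (1/300) * R\<^sup>2 \<le> r\<^sup>2 \<Longrightarrow> q \<in> koranyi_cball p r"
    using ax unfolding axis_like_def by blast+
  define K where "K = koranyi_cball 0 R \<inter> msupp \<mu>"
  have K: "z \<in> msupp \<mu>" "hnorm4 z \<le> R ^ 4" "\<bar>snd z\<bar> \<le> R\<^sup>2" if "z \<in> K" for z
  proof -
    show "z \<in> msupp \<mu>" using that by (simp add: K_def)
    show q: "hnorm4 z \<le> R ^ 4" using that R by (simp add: K_def mem_koranyi_cball hdist4_0)
    have "koranyi_norm z \<le> R" using q R by (simp add: koranyi_norm_pow4[symmetric] power_mono_iff)
    then have "(koranyi_norm z)\<^sup>2 \<le> R\<^sup>2" by (intro power_mono) auto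
    then show "\<bar>snd z\<bar> \<le> R\<^sup>2" using abs_snd_le[of z] by linarith
  qed
  define k where "k z = \<lfloor>150 * (snd z / R\<^sup>2)\<rfloor>" for z :: "'n heis"
  \<comment> \<open>a point of the support over each piece that is met, to serve as the centre of a ball\<close>
  define p where "p i = (SOME z. z \<in> K \<and> k z = i)" for i
  have p: "p (k z) \<in> K \<and> k (p (k z)) = k z" if "z \<in> K" for z
    unfolding p_def by (rule someI[of _ z]) (use that in auto)
  have sub: "k ` K \<subseteq> {-150..150}"
  proof
    fix i assume "i \<in> k ` K"
    then obtain z where z: "z \<in> K" "i = k z" by auto
    have "\<bar>snd z / R\<^sup>2\<bar> \<le> 1" using K(3)[OF z(1)] R by (simp add: divide_le_eq_1)
    then have "- 150 \<le> 150 * (snd z / R\<^sup>2)" "150 * (snd z / R\<^sup>2) \<le> 150" by linarith+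
    then show "i \<in> {-150..150}" using z(2) unfolding k_def by (simp add: le_floor_iff floor_le_iff)
  qed
  have "R ^ \<alpha> \<le> (\<Sum>i\<in>k ` K. (R / 10) ^ \<alpha>)"
  proof (rule covering[of "k ` K" p "\<lambda>_. R / 10" 0])
    show "finite (k ` K)" using sub by (rule finite_subset) auto
    show "p i \<in> msupp \<mu> \<and> 0 < R / 10" if "i \<in> k ` K" for i
    proof -
      from that obtain z where "z \<in> K" "i = k z" by blast
      then have "p i \<in> K" using p by blast
      then show ?thesis using K(1) R by simp
    qed
    show "koranyi_cball 0 R \<inter> msupp \<mu> \<subseteq> (\<Union>i\<in>k ` K. koranyi_cball (p i) (R / 10))"
    proof
      fix z assume "z \<in> koranyi_cball 0 R \<inter> msupp \<mu>"
      then have z: "z \<in> K" by (simp add: K_def)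
      define w where "w = p (k z)"
      have w: "w \<in> K" "k w = k z" using p[OF z] by (auto simp: w_def)
      have "\<bar>150 * (snd w / R\<^sup>2) - 150 * (snd z / R\<^sup>2)\<bar> \<le> 1"
        using w(2) unfolding k_def by linarith
      then have "\<bar>snd w / R\<^sup>2 - snd z / R\<^sup>2\<bar> \<le> 1 / 150" by linarith
      moreover have "\<bar>snd w / R\<^sup>2 - snd z / R\<^sup>2\<bar> = \<bar>snd w - snd z\<bar> / R\<^sup>2"
        using R by (simp add: diff_divide_distrib[symmetric] abs_divide)
      ultimately have "\<bar>snd w - snd z\<bar> \<le> 1 / 150 * R\<^sup>2" using R by (simp add: divide_le_eq)
      then have "z \<in> koranyi_cball w (R / 10)"
        using R by (intro cov K w z) (auto simp: power_divide)
      then show "z \<in> (\<Union>i\<in>k ` K. koranyi_cball (p i) (R / 10))" using z by (auto simp: w_def)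
    qed
  qed (use zero_in_msupp R in auto)
  also have "\<dots> \<le> 301 * (R / 10) ^ \<alpha>"
  proof -
    have "card (k ` K) \<le> card {-150..150::int}" using sub by (intro card_mono) auto
    then have "real (card (k ` K)) \<le> 301" by simp
    then show ?thesis using R by (simp add: mult_right_mono)
  qed
  also have "\<dots> = 301 * (1 / 10) ^ \<alpha> * R ^ \<alpha>" by (simp add: power_divide)
  also have "\<dots> \<le> 301 * (1 / 10) ^ 3 * R ^ \<alpha>"
    using a3 R by (intro mult_right_mono mult_left_mono power_decreasing) auto
  also have "\<dots> < R ^ \<alpha>" using R by (simp add: power_divide)
  finally show False by simp
qed

text \<open>
  Two points \<open>q\<close> and \<open>0\<close> of the support span an interval of heights of length comparable to \<open>R\<^sup>2\<close>.
  Suppose that this interval has a gap, with ends \<open>a < b\<close> and length \<open>L\<close>. The balls of radius just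
  below \<open>sqrt L\<close> about the two ends are disjoint on the support, since each stays on its side of the
  gap, and both lie in the ball of radius \<open>sqrt (2 L)\<close> about one end. Masses equal radii, hence
  \<open>2 sqrt L \<le> sqrt (2 L)\<close> approximately, which is absurd. Without gaps, the interval contains the
  centres of \<open>N\<close> disjoint balls of radius comparable to \<open>R / sqrt N\<close>, with total mass comparable to
  \<open>R sqrt N\<close>, too much for large \<open>N\<close>. The tolerance \<open>1 / 2 ^ 28\<close> is small against the gaps that have to be
  excluded when \<open>N = 2 ^ 12\<close>.
\<close>

lemma axis_like_dim_ne_1:
  assumes ax: "axis_like (msupp \<mu>) (1 / 2 ^ 28) R"
  shows "\<alpha> \<noteq> 1"
proof
  assume a1: "\<alpha> = 1"
  define e :: real where "e = R\<^sup>2 / 2 ^ 28"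
  define S where "S = {p \<in> msupp \<mu>. hnorm4 p \<le> R ^ 4}"
  have R: "0 < R" using ax by (simp add: axis_like_def)
  have e: "0 < e" using R by (simp add: e_def)
  have into: "q \<in> koranyi_cball p r" if "p \<in> S" "q \<in> S" "0 \<le> r" "\<bar>snd p - snd q\<bar> + e \<le> r\<^sup>2" for p q r
    using ax that unfolding axis_like_def S_def e_def by auto
  have out: "\<bar>snd p - snd q\<bar> \<le> r\<^sup>2 + e" if "p \<in> S" "q \<in> S" "0 \<le> r" "q \<in> koranyi_cball p r" for p q r
    using ax that unfolding axis_like_def S_def e_def by auto
  have S0: "0 \<in> S" using zero_in_msupp R by (simp add: S_def hnorm4_def)
  \<comment> \<open>the radius R / 16 leaves room for balls about points with heights between those of 0 and q
    to stay within distance R of 0\<close>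
  have "\<not> koranyi_cball 0 (R / 16) \<inter> msupp \<mu> \<subseteq> koranyi_cball 0 (R / 32)"
  proof
    assume "koranyi_cball 0 (R / 16) \<inter> msupp \<mu> \<subseteq> koranyi_cball 0 (R / 32)"
    then have "(R / 16) ^ \<alpha> \<le> (\<Sum>i\<in>{0::nat}. (R / 32) ^ \<alpha>)"
      using R zero_in_msupp by (intro covering[of "{0::nat}" "\<lambda>_. 0" "\<lambda>_. R / 32" 0]) auto
    then show False using R by (simp add: a1)
  qed
  then obtain q where q: "q \<in> msupp \<mu>" "q \<in> koranyi_cball 0 (R / 16)" "q \<notin> koranyi_cball 0 (R / 32)"
    by blast
  have "hnorm4 q \<le> (R / 16) ^ 4" using q(2) R by (simp add: mem_koranyi_cball hdist4_0)
  moreover have "(R / 16) ^ 4 \<le> R ^ 4" using R by (intro power_mono) auto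
  ultimately have qS: "q \<in> S" and q16: "\<bar>snd q\<bar> \<le> (R / 16)\<^sup>2"
    using q(1) quartic_sum_le(2)[of "fst q" "snd q" "R / 16"] by (auto simp: S_def hnorm4_def)
  have "\<not> \<bar>snd q\<bar> + e \<le> (R / 32)\<^sup>2"
    using into[OF S0 qS, of "R / 32"] q(3) R by auto
  then have q32: "R\<^sup>2 / 2 ^ 11 < \<bar>snd q\<bar>"
    using zero_less_power[OF R, of 2] by (simp add: e_def power_divide)
  \<comment> \<open>0 and q, ordered by height\<close>
  obtain p0 p1 where p01: "p0 \<in> S" "p1 \<in> S" "snd p1 - snd p0 = \<bar>snd q\<bar>"
      "\<bar>snd p0\<bar> \<le> R\<^sup>2 / 256" "\<bar>snd p1\<bar> \<le> R\<^sup>2 / 256"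
  proof (cases "0 \<le> snd q")
    case True
    then show ?thesis using that[OF S0 qS] q16 by (simp add: power_divide)
  next
    case False
    then show ?thesis using that[OF qS S0] q16 by (simp add: power_divide)
  qed
  define lo hi where "lo = snd p0" and "hi = snd p1"
  have len: "R\<^sup>2 / 2 ^ 11 < hi - lo" "hi - lo \<le> R\<^sup>2 / 256"
    using p01(3) q32 q16 by (auto simp: lo_def hi_def power_divide)
  have ball: "koranyi_cball p r \<inter> msupp \<mu> \<subseteq> S \<inter> koranyi_cball 0 (R / 2)"
    if p: "p \<in> S" "lo \<le> snd p" "snd p \<le> hi" and r: "0 \<le> r" "r \<le> R / 8" for p r
  proof
    fix z assume z: "z \<in> koranyi_cball p r \<inter> msupp \<mu>"
    have "\<bar>snd p\<bar> \<le> R\<^sup>2 / 256" using p p01 by (auto simp: lo_def hi_def)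
    then have "\<bar>snd 0 - snd p\<bar> + e \<le> (R / 8)\<^sup>2" by (simp add: e_def power_divide)
    then have "p \<in> koranyi_cball 0 (R / 8)" using into[OF S0 p(1), of "R / 8"] R by simp
    then have p8: "hnorm4 p \<le> (R / 8) ^ 4" using R by (simp add: mem_koranyi_cball hdist4_0)
    have d: "hdist4 p z \<le> r ^ 4" using z r by (simp add: mem_koranyi_cball)
    have "hnorm4 z \<le> 2 * (R / 8 + r) ^ 4"
      using hnorm4_quasi_triangle(3)[OF p8 d] R r by auto
    also have "\<dots> \<le> 2 * (R / 4) ^ 4" using r R by (intro mult_left_mono power_mono) auto
    also have "\<dots> \<le> (R / 2) ^ 4" by (simp add: power_divide)
    finally have z2: "hnorm4 z \<le> (R / 2) ^ 4" .
    have "hnorm4 z \<le> R ^ 4" by (rule order_trans[OF z2 power_mono]) (use R in auto)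
    with z2 show "z \<in> S \<inter> koranyi_cball 0 (R / 2)"
      using z R by (auto simp: S_def mem_koranyi_cball hdist4_0)
  qed
  have gap: "\<exists>p\<in>S. c \<le> snd p \<and> snd p \<le> c + w" if c: "lo \<le> c" "c + w \<le> hi" and w: "8 * e < w" for c w
  proof (rule ccontr)
    assume "\<not> ?thesis"
    then have empty: "snd p < c \<or> c + w < snd p" if "p \<in> S" for p using that by force
    define A where "A = snd ` {p \<in> S. lo \<le> snd p \<and> snd p \<le> c}"
    define B where "B = snd ` {p \<in> S. c + w \<le> snd p \<and> snd p \<le> hi}"
    have "snd p0 \<in> A" "snd p1 \<in> B"
      unfolding A_def B_def using p01 c by (auto intro!: imageI simp: lo_def hi_def)
    moreover have "bdd_above A" "bdd_below B"
      by (auto simp: A_def B_def intro!: bdd_aboveI[of _ c] bdd_belowI[of _ "c + w"])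
    ultimately have A: "A \<noteq> {}" "bdd_above A" and B: "B \<noteq> {}" "bdd_below B" by auto
    \<comment> \<open>the ends of the gap need not be attained, but points within e of them will do\<close>
    obtain a where "a \<in> A" and a: "Sup A - e < a" using less_cSupE[of "Sup A - e" A] A e by auto
    obtain b where "b \<in> B" and b: "b < Inf B + e" using cInf_lessD[of B "Inf B + e"] B e by auto
    obtain pa where pa: "pa \<in> S" "lo \<le> snd pa" "snd pa \<le> c" "a = snd pa" using \<open>a \<in> A\<close> by (auto simp: A_def)
    obtain pb where pb: "pb \<in> S" "c + w \<le> snd pb" "snd pb \<le> hi" "b = snd pb" using \<open>b \<in> B\<close> by (auto simp: B_def)
    define L where "L = b - a"
    have L: "8 * e < L" "L \<le> R\<^sup>2 / 256" using pa pb w len by (auto simp: L_def)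
    define r2 where "r2 = sqrt (L - 4 * e)"
    define r1 where "r1 = sqrt (2 * L)"
    have r2: "0 < r2" "r2\<^sup>2 = L - 4 * e" using L e by (auto simp: r2_def)
    have r1: "0 < r1" "r1\<^sup>2 = 2 * L" using L e by (auto simp: r1_def)
    have "r2\<^sup>2 \<le> (R / 16)\<^sup>2" using r2 L e by (simp add: power_divide)
    then have r28: "r2 \<le> R / 8" using R r2 power2_le_imp_le[of r2 "R / 16"] by auto
    have r21: "r2 \<le> r1" using r2 r1 L e power2_le_imp_le[of r2 r1] by auto
    have za: "z \<in> S \<and> snd z \<le> a + e" if z: "z \<in> koranyi_cball pa r2 \<inter> msupp \<mu>" for z
    proof -
      have zS: "z \<in> S" using ball[OF pa(1,2) _ _ r28] z pa c w e r2 by auto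
      have "\<bar>a - snd z\<bar> \<le> r2\<^sup>2 + e" unfolding pa(4) by (rule out[OF pa(1) zS]) (use r2 z in auto)
      then have zb: "snd z \<le> b - 3 * e" using r2 by (simp add: L_def)
      have "snd z \<le> a + e"
      proof (cases "snd z \<le> c")
        case True
        have "snd z \<le> Sup A" if "lo \<le> snd z"
          using True that zS A by (intro cSup_upper) (auto simp: A_def)
        then show ?thesis using a pa e by (cases "lo \<le> snd z") auto
      next
        case False
        then have "snd z \<in> B" using empty[OF zS] zb pb e zS by (auto simp: B_def)
        then have "Inf B \<le> snd z" using B by (intro cInf_lower)
        then show ?thesis using b zb e by auto
      qed
      then show ?thesis using zS by simp
    qed
    have zb: "z \<in> S \<and> b - e \<le> snd z" if z: "z \<in> koranyi_cball pb r2 \<inter> msupp \<mu>" for z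
    proof -
      have zS: "z \<in> S" using ball[OF pb(1) _ pb(3) _ r28] z pb c w e r2 by auto
      have "\<bar>b - snd z\<bar> \<le> r2\<^sup>2 + e" unfolding pb(4) by (rule out[OF pb(1) zS]) (use r2 z in auto)
      then have za: "a + 3 * e \<le> snd z" using r2 by (simp add: L_def)
      have "b - e \<le> snd z"
      proof (cases "c + w \<le> snd z")
        case True
        have "Inf B \<le> snd z" if "snd z \<le> hi"
          using True that zS B by (intro cInf_lower) (auto simp: B_def)
        then show ?thesis using b pb e by (cases "snd z \<le> hi") auto
      next
        case False
        then have "snd z \<in> A" using empty[OF zS] za pa e zS by (auto simp: A_def)
        then have "snd z \<le> Sup A" using A by (intro cSup_upper)
        then show ?thesis using a za e by auto
      qed
      then show ?thesis using zS by simp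
    qed
    have ne: "pa \<noteq> pb" using L e pa pb by (auto simp: L_def)
    have "(\<Sum>i\<in>{pa, pb}. r2 ^ \<alpha>) \<le> r1 ^ \<alpha>"
    proof (rule packing[of "{pa, pb}" "\<lambda>p. p" "\<lambda>_. r2" pa r1])
      show "koranyi_cball i r2 \<inter> msupp \<mu> \<subseteq> koranyi_cball pa r1" if "i \<in> {pa, pb}" for i
      proof (cases "i = pa")
        case True
        have "r2 ^ 4 \<le> r1 ^ 4" using r21 r2(1) by (intro power_mono) auto
        then have "koranyi_cball pa r2 \<subseteq> koranyi_cball pa r1"
          using r1(1) r2(1) mem_koranyi_cball[of r1 _ pa] mem_koranyi_cball[of r2 _ pa]
          by (fastforce intro: order_trans)
        then show ?thesis using True by blast
      next
        case False
        then have i: "i = pb" using that by simp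
        show ?thesis
        proof
          fix z assume z: "z \<in> koranyi_cball i r2 \<inter> msupp \<mu>"
          then have zS: "z \<in> S" using zb i by blast
          have "\<bar>b - snd z\<bar> \<le> r2\<^sup>2 + e" unfolding pb(4) by (rule out[OF pb(1) zS]) (use r2 z i in auto)
          then have "\<bar>snd pa - snd z\<bar> + e \<le> r1\<^sup>2"
            using r1 r2 L e pa(4) by (simp add: L_def abs_le_iff)
          then show "z \<in> koranyi_cball pa r1" using into[OF pa(1) zS] r1 by simp
        qed
      qed
      have disj: "koranyi_cball pa r2 \<inter> msupp \<mu> \<inter> (koranyi_cball pb r2 \<inter> msupp \<mu>) = {}"
        using za zb L e by (force simp: L_def)
      show "disjoint_family_on (\<lambda>i. koranyi_cball i r2 \<inter> msupp \<mu>) {pa, pb}"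
        using disj ne by (auto simp: disjoint_family_on_def)
    qed (use pa pb r1 r2 in \<open>auto simp: S_def\<close>)
    then have "2 * r2 \<le> r1" using ne by (simp add: a1)
    then have "(2 * r2)\<^sup>2 \<le> r1\<^sup>2" using r2 by (intro power_mono) auto
    then show False using r1 r2 L by (simp add: power_mult_distrib)
  qed
  \<comment> \<open>2 ^ 12 pieces of length w, separated by spaces of length w; each contains a point of the support\<close>
  define w where "w = (hi - lo) / 2 ^ 13"
  have w: "8 * e < w" "w \<le> R\<^sup>2 / 256 / 2 ^ 13" "0 < w"
    using len e zero_less_power[OF R, of 2] by (auto simp: w_def e_def)
  define c where "c j = lo + 2 * real j * w" for j :: nat
  have cj: "lo \<le> c j" "c j + w \<le> hi" if "j < 2 ^ 12" for j
  proof -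
    show "lo \<le> c j" using w by (simp add: c_def)
    have "(2 * real j + 1) * w \<le> 2 ^ 13 * w"
    proof (rule mult_right_mono)
      have "real (2 * j + 1) \<le> real (2 ^ 13)" using that by (intro of_nat_mono) simp
      then show "2 * real j + 1 \<le> 2 ^ 13" by simp
    qed (use w in simp)
    moreover have "2 ^ 13 * w = hi - lo" by (simp add: w_def)
    moreover have "c j + w = lo + (2 * real j + 1) * w" by (simp add: c_def algebra_simps)
    ultimately show "c j + w \<le> hi" by linarith
  qed
  have "\<exists>p\<in>S. c j \<le> snd p \<and> snd p \<le> c j + w" if "j < 2 ^ 12" for j
    using gap[OF cj[OF that] w(1)] .
  then obtain P where P: "\<And>j. j < 2 ^ 12 \<Longrightarrow> P j \<in> S \<and> c j \<le> snd (P j) \<and> snd (P j) \<le> c j + w"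
    by metis
  have Pr: "lo \<le> snd (P j) \<and> snd (P j) \<le> hi" if "j < 2 ^ 12" for j
    using P[OF that] cj[OF that] by linarith
  \<comment> \<open>two such points differ in height by at least w, which exceeds twice the square of this radius\<close>
  define r where "r = sqrt (w / 3)"
  have r: "0 < r" "r\<^sup>2 = w / 3" using w by (auto simp: r_def)
  have "r\<^sup>2 \<le> (R / 8)\<^sup>2" using r w zero_less_power[OF R, of 2] by (simp add: power_divide)
  then have r8: "r \<le> R / 8" by (rule power2_le_imp_le) (use R in simp)
  have far: "w \<le> \<bar>snd (P i) - snd (P j)\<bar>" if "i < 2 ^ 12" "j < 2 ^ 12" "i < j" for i j
  proof -
    have "(2 * real i + 2) * w \<le> (2 * real j) * w" using that w by (intro mult_right_mono) auto
    then show ?thesis using P[OF that(1)] P[OF that(2)] by (simp add: c_def algebra_simps)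
  qed
  have "(\<Sum>j\<in>{..<2 ^ 12::nat}. r ^ \<alpha>) \<le> (R / 2) ^ \<alpha>"
  proof (rule packing[of "{..<2 ^ 12::nat}" P "\<lambda>_. r" 0 "R / 2"])
    show "P i \<in> msupp \<mu> \<and> 0 < r" if "i \<in> {..<2 ^ 12}" for i
      using P that r by (auto simp: S_def)
    show sub: "koranyi_cball (P i) r \<inter> msupp \<mu> \<subseteq> koranyi_cball 0 (R / 2)" if "i \<in> {..<2 ^ 12}" for i
      using ball[of "P i" r] P[of i] Pr[of i] r r8 that by auto
    show "disjoint_family_on (\<lambda>i. koranyi_cball (P i) r \<inter> msupp \<mu>) {..<2 ^ 12}"
      unfolding disjoint_family_on_def
    proof (intro ballI impI equals0I)
      fix i j z assume ij: "i \<in> {..<2 ^ 12::nat}" "j \<in> {..<2 ^ 12::nat}" "i \<noteq> j"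
        and z: "z \<in> koranyi_cball (P i) r \<inter> msupp \<mu> \<inter> (koranyi_cball (P j) r \<inter> msupp \<mu>)"
      have zS: "z \<in> S" using ball[of "P i" r] P[of i] Pr[of i] r r8 ij z by auto
      have "\<bar>snd (P i) - snd z\<bar> \<le> r\<^sup>2 + e" "\<bar>snd (P j) - snd z\<bar> \<le> r\<^sup>2 + e"
        by (rule out; use P ij zS z r in auto)+
      then have "\<bar>snd (P i) - snd (P j)\<bar> \<le> 2 * (w / 3) + 2 * e" unfolding r(2) by linarith
      moreover have "w \<le> \<bar>snd (P i) - snd (P j)\<bar>"
        using far[of i j] far[of j i] ij by (cases "i < j") (auto simp: abs_minus_commute)
      ultimately show False using w e by linarith
    qed
  qed (use zero_in_msupp R in auto)
  then have "2 ^ 12 * r \<le> R / 2" by (simp add: a1)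
  then have "(2 ^ 12 * r)\<^sup>2 \<le> (R / 2)\<^sup>2" using r by (intro power_mono) auto
  then have "2 ^ 24 * (w / 3) \<le> R\<^sup>2 / 4" unfolding power_mult_distrib r(2) by (simp add: power_divide)
  moreover have "R\<^sup>2 / 2 ^ 24 < w" using len by (simp add: w_def)
  ultimately show False using zero_less_power[OF R, of 2] by simp
qed

end

section \<open>The quadric\<close>

theorem theorem1p4:
  fixes \<mu> :: "'n::finite heis measure" and \<alpha> :: nat
  assumes "\<alpha> \<in> {1..2 * CARD('n) + 1} - {2}"
    and "heis_uniform (real \<alpha>) \<mu>"
  shows "\<exists>(b :: real ^ ('n + 'n)) (T :: real) (Q :: real ^ ('n + 'n) ^ ('n + 'n)).
           transpose Q = Q \<and> trace Q \<noteq> 0 \<and> msupp \<mu> \<subseteq> heis_quadric b Q T"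
proof (rule quadric_of_not_in_span, rule notI)
  assume span: "((0, mat 1, 0) :: 'n coeffs) \<in> span (monomials ` msupp \<mu>)"
  have pos: "1 \<le> \<alpha>" and dim: "\<alpha> \<le> 2 * CARD('n) + 1" and "\<alpha> \<noteq> 2"
    using assms(1) by auto
  interpret heis_uniform_measure \<mu> \<alpha>
    by unfold_locales (use assms pos in auto)
  have small: "\<exists>l>0. gauss_width \<mu> \<alpha> l \<le> e" if e: "0 < e" for e
  proof -
    obtain d where "0 < d" "\<And>l. 0 < l \<Longrightarrow> l < d \<Longrightarrow> gauss_width \<mu> \<alpha> l \<le> e"
      using gauss_width_small[OF trace_tendsto_0[OF span] dim e] by blast
    then show ?thesis by (intro exI[of _ "d / 2"]) auto
  qed
  obtain R where "axis_like (msupp \<mu>) (1 / 300) R"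
    using axis_like_scale[OF small, of "1 / 300"] by auto
  then have "\<alpha> < 3" by (rule axis_like_dim_less_3)
  obtain R' where "axis_like (msupp \<mu>) (1 / 2 ^ 28) R'"
    using axis_like_scale[OF small, of "1 / 2 ^ 28"] by auto
  then have "\<alpha> \<noteq> 1" by (rule axis_like_dim_ne_1)
  then show False using pos \<open>\<alpha> < 3\<close> \<open>\<alpha> \<noteq> 2\<close> by linarith
qed

end
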